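(* Let $G = K \rtimes_\varphi \langle t\rangle$ be a finitely generated group, where $K$ is abelian, $\langle t\rangle$ is infinite cyclic and $\varphi\in\mathrm{Aut}(K)$, and suppose $G$ has exponential growth. Let $R$ be a finite symmetric subset of $K$ such that $S=\{(r,1),(0,t^{\pm1}) : r\in R\}$ generates $G$. Then $$\frac{c(S^r)}{|S^r|}=O\!\left(\frac{\log r}{r}\right)\quad (r\to\infty).$$
   Context: $K$ is written additively; elements of $G$ are pairs $(k,t^m)$ with $k\in K$, $m\in\mathbb Z$, with multiplication $(k,t^m)(k',t^{m'})=(k+\varphi^m(k'),t^{m+m'})$, so that $t k t^{-1}=\varphi(k)$; we identify $k$ with $(k,1)$ and $t^m$ with $(0,t^m)$. For a finite symmetric generating set $S$, $S^r$ denotes the set of elements of $G$ of word length at most $r$ with respect to $S$ (the ball of radius $r$). For a subset $A\subseteq G$, $c(A)$ denotes the number of distinct conjugacy classes of $G$ that meet $A$. *)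

theory Defs
  imports Complex_Main "HOL-Library.Landau_Symbols"
begin

text \<open>The semidirect product G = K \<rtimes>_phi <t>: elements (k, m) stand for (k, t^m).
  K is the (additive, abelian) group given by the type 'k.\<close>

definition autom :: "('k::ab_group_add \<Rightarrow> 'k) \<Rightarrow> bool" where
  "autom phi \<longleftrightarrow> bij phi \<and> (\<forall>a b. phi (a + b) = phi a + phi b)"

definition phipow :: "('k \<Rightarrow> 'k) \<Rightarrow> int \<Rightarrow> 'k \<Rightarrow> 'k" where
  "phipow phi m = (if m \<ge> 0 then phi ^^ nat m else (inv phi) ^^ nat (- m))"

definition sdmul :: "('k::ab_group_add \<Rightarrow> 'k) \<Rightarrow> 'k \<times> int \<Rightarrow> 'k \<times> int \<Rightarrow> 'k \<times> int" where
  "sdmul phi x y = (fst x + phipow phi (snd x) (fst y), snd x + snd y)"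

definition sdinv :: "('k::ab_group_add \<Rightarrow> 'k) \<Rightarrow> 'k \<times> int \<Rightarrow> 'k \<times> int" where
  "sdinv phi x = (- phipow phi (- snd x) (fst x), - snd x)"

definition sdone :: "'k::ab_group_add \<times> int" where
  "sdone = (0, 0)"

fun sdball :: "('k::ab_group_add \<Rightarrow> 'k) \<Rightarrow> ('k \<times> int) set \<Rightarrow> nat \<Rightarrow> ('k \<times> int) set" where
  "sdball phi S 0 = {sdone}"
| "sdball phi S (Suc r) = sdball phi S r \<union> {sdmul phi x s | x s. x \<in> sdball phi S r \<and> s \<in> S}"

definition sdgenerates :: "('k::ab_group_add \<Rightarrow> 'k) \<Rightarrow> ('k \<times> int) set \<Rightarrow> bool" where
  "sdgenerates phi S \<longleftrightarrow> (\<Union>r. sdball phi S r) = UNIV"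

definition symmetric_gen :: "('k::ab_group_add \<Rightarrow> 'k) \<Rightarrow> ('k \<times> int) set \<Rightarrow> bool" where
  "symmetric_gen phi S \<longleftrightarrow> (\<forall>s\<in>S. sdinv phi s \<in> S)"

text \<open>Exponential growth: for some finite symmetric generating set the ball sizes grow at
  least like c^r with c > 1 (this is independent of the generating set).\<close>
definition sd_exp_growth :: "('k::ab_group_add \<Rightarrow> 'k) \<Rightarrow> bool" where
  "sd_exp_growth phi \<longleftrightarrow> (\<exists>T. finite T \<and> symmetric_gen phi T \<and> sdgenerates phi T \<and>
      (\<exists>c::real. c > 1 \<and> (\<forall>r. c ^ r \<le> real (card (sdball phi T r)))))"

definition sdconjclass :: "('k::ab_group_add \<Rightarrow> 'k) \<Rightarrow> 'k \<times> int \<Rightarrow> ('k \<times> int) set" where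
  "sdconjclass phi g = {sdmul phi (sdmul phi h g) (sdinv phi h) | h. True}"

definition nconj :: "('k::ab_group_add \<Rightarrow> 'k) \<Rightarrow> ('k \<times> int) set \<Rightarrow> nat" where
  "nconj phi A = card (sdconjclass phi ` A)"

end

theory Submission
  imports
    Defs
    "HOL-Computational_Algebra.Polynomial"
    "HOL-Library.FuncSet"
    "HOL-Real_Asymp.Real_Asymp"
begin

text \<open>
  Write a word of length at most \<open>n\<close> for \<open>g = (k, m)\<close> and look at the heights (exponents of \<open>t\<close>) of
  its prefixes; they fill an interval. Put \<open>L \<approx> \<delta> n / log n\<close>.
  If the interval has length below \<open>d0 L\<close>, then \<open>k\<close> is given by polynomials in \<open>\<phi>\<close> with few bounded
  coefficients, so there are only \<open>n ^ O(L)\<close> such elements. Otherwise choose prefixes at \<open>L + 1\<close>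
  heights spaced by \<open>d0\<close>. The corresponding cyclic permutations of the word are conjugates of \<open>g\<close> in the
  ball. If they are distinct, the class of \<open>g\<close> has more than \<open>L\<close> elements in the ball, which happens for
  at most \<open>|ball| / (L + 1)\<close> classes. If two coincide, the class contains an element \<open>(k, m)\<close> of the ball
  that commutes with some \<open>(h, t^(d0 d))\<close> of length at most \<open>2 n\<close>, where \<open>0 < d \<le> L\<close>.

  In the last case the class is determined by \<open>m\<close>, \<open>d\<close> and the residues of \<open>k\<close> and \<open>h\<close> modulo a fixed power
  of \<open>\<phi>^(d0 d) - 1\<close>, and these residues take only \<open>n ^ O(L)\<close> values. They suffice because \<open>K\<close> is
  noetherian: all \<open>\<phi>\<close>-periodic elements have a common period \<open>d0\<close>, and no nonzero one of
  them lies in \<open>(\<phi>^(d0 d) - 1)^e K\<close> when \<open>e\<close> is large. As the ball grows exponentially,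
  a small \<open>\<delta>\<close> makes \<open>n ^ O(L)\<close> negligible.
\<close>

section \<open>Noetherian modules over the integer polynomials\<close>

text \<open>A nonzero element of least absolute value works: the remainder of any \<open>a\<close>
  modulo it stays in \<open>A\<close> and is smaller, hence zero.\<close>

lemma int_subgroup_generator:
  fixes A :: "int set"
  assumes z: "0 \<in> A" and d: "\<And>a b. a \<in> A \<Longrightarrow> b \<in> A \<Longrightarrow> a - b \<in> A"
    and m: "\<And>c a. a \<in> A \<Longrightarrow> c * a \<in> A"
  shows "\<exists>g\<in>A. \<forall>a\<in>A. g dvd a"
proof (cases "A \<subseteq> {0}")
  case True
  then show ?thesis using z by auto
next
  case False
  then obtain b where b: "b \<in> A" "b \<noteq> 0" by auto
  define P where "P = (\<lambda>n. \<exists>a\<in>A. a \<noteq> 0 \<and> n = nat \<bar>a\<bar>)"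
  have "P (nat \<bar>b\<bar>)" using b by (auto simp: P_def)
  then have L: "P (LEAST n. P n)" by (rule LeastI)
  then obtain g where g: "g \<in> A" "g \<noteq> 0" "(LEAST n. P n) = nat \<bar>g\<bar>" by (auto simp: P_def)
  have "g dvd a" if a: "a \<in> A" for a
  proof (rule ccontr)
    assume nd: "\<not> g dvd a"
    have r: "a mod g \<in> A" using d[OF a m[OF g(1), of "a div g"]] by (simp add: minus_div_mult_eq_mod)
    have "a mod g \<noteq> 0" using nd by auto
    with r have "P (nat \<bar>a mod g\<bar>)" by (auto simp: P_def)
    then have "nat \<bar>g\<bar> \<le> nat \<bar>a mod g\<bar>" using Least_le[of P] g(3) by metis
    moreover have "\<bar>a mod g\<bar> < \<bar>g\<bar>" using g(2) by (rule abs_mod_less)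
    ultimately show False by linarith
  qed
  then show ?thesis using g(1) by blast
qed

text \<open>Viewing Z[x] as a module over itself turns ideals into \<open>subspace\<close>s and
  generated ideals into \<open>span\<close>s.\<close>

interpretation int_poly_ideal: module "(*) :: int poly \<Rightarrow> int poly \<Rightarrow> int poly"
  by unfold_locales (auto simp: algebra_simps)

text \<open>Hilbert's argument through leading coefficients. For each \<open>j\<close>, the
  coefficients at \<open>x^j\<close> of members of \<open>I\<close> of degree at most
  \<open>j\<close> form an ideal of Z, generated by that of some \<open>f j\<close>. These ideals
  grow with \<open>j\<close> and stabilise at some \<open>J\<close>, and
  \<open>f 0, ..., f J\<close> then generate \<open>I\<close> by cancelling leading terms.\<close>

lemma hilbert_basis_int_poly:
  fixes I :: "int poly set"
  assumes I: "int_poly_ideal.subspace I"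
  shows "\<exists>F. finite F \<and> F \<subseteq> I \<and> I \<subseteq> int_poly_ideal.span F"
proof -
  note z = int_poly_ideal.subspace_0[OF I]
    and a = int_poly_ideal.subspace_diff[OF I] and m = int_poly_ideal.subspace_scale[OF I]
  have "\<exists>f. f \<in> I \<and> degree f \<le> j \<and> (\<forall>p\<in>I. degree p \<le> j \<longrightarrow> coeff f j dvd coeff p j)" for j
  proof -
    let ?A = "{coeff p j | p. p \<in> I \<and> degree p \<le> j}"
    have "0 \<in> ?A" using z by force
    moreover have "a - b \<in> ?A" if "a \<in> ?A" "b \<in> ?A" for a b
    proof -
      from that obtain p q where "p \<in> I" "degree p \<le> j" "a = coeff p j"
        "q \<in> I" "degree q \<le> j" "b = coeff q j" by auto
      then show ?thesis using a[of p q] degree_diff_le[of p j q] by (auto intro!: exI[of _ "p - q"])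
    qed
    moreover have "c * a \<in> ?A" if "a \<in> ?A" for c a
    proof -
      from that obtain p where "p \<in> I" "degree p \<le> j" "a = coeff p j" by auto
      then show ?thesis using m[of p "[:c:]"] degree_smult_le[of c p]
        by (auto intro!: exI[of _ "smult c p"])
    qed
    ultimately have "\<exists>g\<in>?A. \<forall>a\<in>?A. g dvd a" by (rule int_subgroup_generator)
    then show ?thesis by blast
  qed
  then obtain f where f: "\<And>j. f j \<in> I" "\<And>j. degree (f j) \<le> j"
    "\<And>j p. p \<in> I \<Longrightarrow> degree p \<le> j \<Longrightarrow> coeff (f j) j dvd coeff p j" by metis
  define c where "c j = coeff (f j) j" for j
  have step: "c (Suc j) dvd c j" for j
  proof -
    \<comment> \<open>The multiple \<open>x f_j\<close> lies in \<open>I\<close>, and its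
      coefficient at \<open>x^(j+1)\<close> is \<open>c j\<close>.\<close>
    have "c (Suc j) dvd coeff (monom 1 1 * f j) (Suc j)"
      unfolding c_def by (rule f(3)[OF m[OF f(1)]])
        (use degree_mult_le[of "monom (1::int) 1" "f j"] f(2)[of j] in \<open>simp add: degree_monom_eq\<close>)
    then show ?thesis by (simp add: c_def monom_altdef)
  qed
  have chain: "c j dvd c i" if "i \<le> j" for i j
    using that by (induction rule: dec_induct) (auto intro: dvd_trans[OF step])
  obtain J where J: "\<And>j. J \<le> j \<Longrightarrow> c J dvd c j"
  proof (cases "\<forall>j. c j = 0")
    case True
    then show ?thesis using that[of 0] by auto
  next
    case False
    then obtain i where i: "c i \<noteq> 0" by auto
    \<comment> \<open>Past a nonzero \<open>c J\<close> of least absolute value, \<open>c j\<close>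
      divides \<open>c J\<close> and cannot be smaller, so the two agree up to sign.\<close>
    define J where "J = (ARG_MIN (\<lambda>j. nat \<bar>c j\<bar>) j. c j \<noteq> 0)"
    have J: "c J \<noteq> 0" "\<And>j. c j \<noteq> 0 \<Longrightarrow> nat \<bar>c J\<bar> \<le> nat \<bar>c j\<bar>"
      using arg_min_nat_lemma[of "\<lambda>j. c j \<noteq> 0" i "\<lambda>j. nat \<bar>c j\<bar>"] i by (auto simp: J_def)
    have "c J dvd c j" if "J \<le> j" for j
    proof -
      have d: "c j dvd c J" using chain that by blast
      then have "c j \<noteq> 0" using J(1) by auto
      then have "\<bar>c J\<bar> \<le> \<bar>c j\<bar>" using J(2) by fastforce
      moreover have "\<bar>c j\<bar> \<le> \<bar>c J\<bar>" using d J(1) by (rule dvd_imp_le_int[rotated])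
      ultimately have "\<bar>c J\<bar> = \<bar>c j\<bar>" by simp
      then show ?thesis by (metis abs_dvd_iff dvd_abs_iff dvd_refl)
    qed
    then show ?thesis using that by blast
  qed
  define J' where "J' = int_poly_ideal.span (f ` {..J})"
  have "I \<subseteq> J'"
  proof
    fix p assume "p \<in> I"
    then show "p \<in> J'"
    proof (induction "degree p" arbitrary: p rule: less_induct)
      case less
      \<comment> \<open>Up to degree \<open>J\<close> the matching \<open>f ?j\<close> cancels the
        leading term; above it, a shift of \<open>f J\<close> does.\<close>
      let ?j = "degree p" let ?i = "min ?j J"
      have "c ?i dvd coeff p ?j"
        using f(3)[OF less(2), of ?j] J[of ?j]
        by (cases "?j \<le> J") (auto simp: c_def min_def intro: dvd_trans)
      then obtain u where u: "coeff p ?j = c ?i * u" by auto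
      define q where "q = monom u (?j - ?i) * f ?i"
      have qJ: "q \<in> J'" unfolding q_def J'_def
        by (intro int_poly_ideal.span_scale int_poly_ideal.span_base) auto
      have qI: "p - q \<in> I" unfolding q_def using a m f(1) less(2) by blast
      have dq: "degree q \<le> ?j"
        unfolding q_def using degree_mult_le[of "monom u (?j - ?i)" "f ?i"] f(2)[of ?i]
          degree_monom_le[of u "?j - ?i"] by linarith
      have cq: "coeff q ?j = coeff p ?j"
        unfolding q_def u by (simp add: coeff_monom_mult c_def)
      have "p - q \<in> J'"
      proof (cases "p - q = 0")
        case True then show ?thesis by (simp add: J'_def int_poly_ideal.span_zero)
      next
        case False
        have "degree (p - q) \<le> ?j" using dq by (simp add: degree_diff_le)
        moreover have "degree (p - q) \<noteq> ?j"
          using cq False by (metis coeff_diff diff_self leading_coeff_0_iff)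
        ultimately show ?thesis using less(1)[OF _ qI] by simp
      qed
      then have "p - q + q \<in> J'" using qJ int_poly_ideal.span_add unfolding J'_def by blast
      then show ?case by simp
    qed
  qed
  then show ?thesis using f(1) by (intro exI[of _ "f ` {..J}"]) (auto simp: J'_def)
qed

locale int_poly_module = module scale
  for scale :: "int poly \<Rightarrow> 'b::ab_group_add \<Rightarrow> 'b" (infixr "\<cdot>" 75)
begin

text \<open>Induction on the generators. The part of \<open>N\<close> inside \<open>span R\<close>
  is covered by the induction hypothesis. The coefficients of \<open>r\<close> that occur in
  \<open>N\<close> modulo \<open>span R\<close> form an ideal, whose finitely many generators are
  lifted to \<open>N\<close>.\<close>

lemma noetherian:
  assumes "finite R" "subspace N" "N \<subseteq> span R"
  shows "\<exists>F. finite F \<and> F \<subseteq> N \<and> N \<subseteq> span F"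
  using assms
proof (induction R arbitrary: N rule: finite_induct)
  case empty
  then show ?case by (auto intro!: exI[of _ "{}"])
next
  case (insert r R)
  have "\<exists>F. finite F \<and> F \<subseteq> N \<inter> span R \<and> N \<inter> span R \<subseteq> span F"
    by (rule insert.IH) (auto intro: subspace_inter insert.prems)
  then obtain F where F: "finite F" "F \<subseteq> N \<inter> span R" "N \<inter> span R \<subseteq> span F" by auto
  define I where "I = {p. \<exists>y\<in>N. y - p \<cdot> r \<in> span R}"
  have "int_poly_ideal.subspace I"
  proof (rule int_poly_ideal.subspaceI)
    show "0 \<in> I" unfolding I_def using subspace_0[OF insert.prems(1)]
    by (auto intro!: bexI[of _ 0] simp: span_zero)
    show "p + q \<in> I" if "p \<in> I" "q \<in> I" for p q
  proof -
    from that obtain x y where "x \<in> N" "x - p \<cdot> r \<in> span R" "y \<in> N" "y - q \<cdot> r \<in> span R"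
      by (auto simp: I_def)
    then have "(x - p \<cdot> r) + (y - q \<cdot> r) \<in> span R" "x + y \<in> N"
      using span_add subspace_add[OF insert.prems(1)] by blast+
    then show ?thesis unfolding I_def
      by (auto intro!: bexI[of _ "x + y"] simp: scale_left_distrib algebra_simps)
  qed
    show "c * p \<in> I" if "p \<in> I" for c p
  proof -
    from that obtain x where "x \<in> N" "x - p \<cdot> r \<in> span R" by (auto simp: I_def)
    then have "c \<cdot> (x - p \<cdot> r) \<in> span R" "c \<cdot> x \<in> N"
      using span_scale subspace_scale[OF insert.prems(1)] by blast+
    then show ?thesis unfolding I_def
      by (auto intro!: bexI[of _ "c \<cdot> x"] simp: scale_right_diff_distrib)
  qed
  qed
  then obtain G where G: "finite G" "G \<subseteq> I" "I \<subseteq> int_poly_ideal.span G"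
    using hilbert_basis_int_poly by blast
  from G(2) have "\<forall>p\<in>G. \<exists>y. y \<in> N \<and> y - p \<cdot> r \<in> span R" by (auto simp: I_def)
  then obtain y where y: "\<And>p. p \<in> G \<Longrightarrow> y p \<in> N \<and> y p - p \<cdot> r \<in> span R" by metis
  let ?F = "F \<union> y ` G"
  have sub: "?F \<subseteq> N" using F y by auto
  have I: "\<exists>x\<in>span ?F. x - p \<cdot> r \<in> span R" if "p \<in> int_poly_ideal.span G" for p
    using that
  proof (induction rule: int_poly_ideal.span_induct_alt)
    case base
    then show ?case by (auto intro!: bexI[of _ 0] simp: span_zero)
  next
    case (step c p q)
    then obtain b where "b \<in> span ?F" "b - q \<cdot> r \<in> span R" by auto
    moreover have "y p \<in> span ?F" using step(1) by (auto intro: span_base)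
    ultimately have "c \<cdot> (y p - p \<cdot> r) + (b - q \<cdot> r) \<in> span R" "c \<cdot> y p + b \<in> span ?F"
      using y[OF step(1)] by (auto intro!: span_add span_scale)
    then show ?case
      by (intro bexI[of _ "c \<cdot> y p + b"])
        (auto simp: scale_left_distrib scale_right_diff_distrib algebra_simps)
  qed
  have "N \<subseteq> span ?F"
  proof
    fix x assume x: "x \<in> N"
    with insert.prems(2) obtain p where "x - p \<cdot> r \<in> span R"
      unfolding span_insert by blast
    with x have "p \<in> I" by (auto simp: I_def)
    \<comment> \<open>A combination of the lifts has the same \<open>r\<close>-coefficient as
      \<open>x\<close> modulo \<open>span R\<close>, so \<open>x - z\<close> falls into
      \<open>N \<inter> span R\<close>.\<close>
    with I G(3) obtain z where z: "z \<in> span ?F" "z - p \<cdot> r \<in> span R" by auto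
    have "z \<in> N" using z(1) sub insert.prems(1) by (metis span_minimal subsetD)
    have "(x - p \<cdot> r) - (z - p \<cdot> r) \<in> span R" using \<open>x - p \<cdot> r \<in> span R\<close> z(2) by (rule span_diff)
    then have "x - z \<in> span R" by simp
    moreover have "x - z \<in> N" using x \<open>z \<in> N\<close> insert.prems(1) subspace_diff by blast
    ultimately have "x - z \<in> span ?F" using F(3) span_mono[of F ?F] by auto
    then have "(x - z) + z \<in> span ?F" using z(1) span_add by blast
    then show "x \<in> span ?F" by simp
  qed
  then show ?case using sub F(1) G(1) by (intro exI[of _ ?F]) auto
qed

end

section \<open>Semidirect products by an infinite cyclic group\<close>

text \<open>The integer multiple \<open>n x\<close>, available in every abelian group; at least one
  of the two sums is empty.\<close>

definition int_scale :: "int \<Rightarrow> 'a::ab_group_add \<Rightarrow> 'a" where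
  "int_scale n x = (\<Sum>_<nat n. x) - (\<Sum>_<nat (- n). x)"

lemma sum_const_add_nat: "(\<Sum>_<m + n. x) = (\<Sum>_<m. x) + (\<Sum>_<n. x :: 'a::ab_group_add)" for m n :: nat
  by (induction n) (auto simp: algebra_simps)

text \<open>Allowing any representation of the scalar as a difference of naturals makes additivity
  in the scalar provable without sign cases.\<close>

lemma int_scale_diff: "int_scale (int m - int n) x = (\<Sum>_<m. x) - (\<Sum>_<n. x)"
proof (cases "n \<le> m")
  case True
  then show ?thesis using sum_const_add_nat[of x n "m - n"]
    by (simp add: int_scale_def nat_diff_distrib algebra_simps flip: of_nat_diff)
next
  case False
  then show ?thesis using sum_const_add_nat[of x m "n - m"]
    by (simp add: int_scale_def nat_diff_distrib algebra_simps flip: of_nat_diff)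
qed

interpretation int_scale: module "int_scale :: int \<Rightarrow> 'a::ab_group_add \<Rightarrow> 'a"
proof
  fix a b :: int and x y :: 'a
  show add_right: "int_scale a (x + y) = int_scale a x + int_scale a y" for a x y
    by (simp add: int_scale_def sum.distrib)
  show add_left: "int_scale (a + b) x = int_scale a x + int_scale b x" for a b x
  proof -
    obtain m n m' n' where "a = int m - int n" "b = int m' - int n'"
      by (metis int_diff_cases)
    moreover from this have "a + b = int (m + m') - int (n + n')" by simp
    ultimately show ?thesis
      by (simp only: int_scale_diff sum_const_add_nat) (simp add: algebra_simps)
  qed
  show one: "int_scale 1 x = x" for x by (simp add: int_scale_def)
  have zero: "int_scale 0 x = 0" for x by (simp add: int_scale_def)
  have minus: "int_scale (- a) x = - int_scale a x" for a x by (simp add: int_scale_def)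
  have nat: "int_scale (int n) (int_scale b x) = int_scale (int n * b) x" for n
    by (induction n) (auto simp: zero add_left one algebra_simps)
  show "int_scale a (int_scale b x) = int_scale (a * b) x"
  proof (cases a rule: int_cases2)
    case (nonneg n)
    then show ?thesis using nat by simp
  next
    case (nonpos n)
    then show ?thesis using nat[of n] by (simp add: minus)
  qed
qed

section \<open>Powers of the automorphism and the action of Z[x] on K\<close>

locale abelian_automorphism =
  fixes phi :: "'k::ab_group_add \<Rightarrow> 'k"
  assumes autom: "autom phi"
begin

lemma bij_phi: "bij phi" and phi_add: "phi (x + y) = phi x + phi y"
  using autom by (auto simp: autom_def)

sublocale phi: additive phi
  by unfold_locales (rule phi_add)

lemma phipow_0 [simp]: "phipow phi 0 x = x"
  by (simp add: phipow_def)

lemma phipow_Suc: "phipow phi (m + 1) x = phi (phipow phi m x)"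
proof (cases "m \<ge> 0")
  case True
  then show ?thesis by (simp add: phipow_def nat_add_distrib)
next
  case False
  then obtain n where n: "m = - int (Suc n)"
    by (metis int_cases not_le of_nat_0_le_iff)
  have "phi (inv phi y) = y" for y using bij_phi by (simp add: bij_def surj_f_inv_f)
  then show ?thesis using n by (simp add: phipow_def nat_add_distrib)
qed

lemma phipow_add: "phipow phi (m + n) x = phipow phi m (phipow phi n x)"
proof (induction m rule: int_induct[where k = 0])
  case base
  then show ?case by simp
next
  case (step1 i)
  then show ?case using phipow_Suc[of "i + n"] phipow_Suc[of i] by (simp add: algebra_simps)
next
  case (step2 i)
  have "phi (phipow phi (i - 1 + n) x) = phi (phipow phi (i - 1) (phipow phi n x))"
    using phipow_Suc[of "i - 1 + n"] phipow_Suc[of "i - 1"] step2 by (simp add: algebra_simps)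
  then show ?case using bij_phi by (simp add: bij_def inj_eq)
qed

lemma phipow_minus_cancel [simp]:
  "phipow phi (- m) (phipow phi m x) = x" "phipow phi m (phipow phi (- m) x) = x"
  using phipow_add[of "- m" m x] phipow_add[of m "- m" x] by auto

lemma phipow_of_nat: "phipow phi (int n) = phi ^^ n"
  by (simp add: phipow_def)

lemma phipow_commute: "phipow phi m (phi x) = phi (phipow phi m x)"
  using phipow_Suc[of m x] phipow_add[of m 1 x] phipow_of_nat[of 1] by simp

lemma phipow_additive: "phipow phi m (x + y) = phipow phi m x + phipow phi m y"
proof (induction m rule: int_induct[where k = 0])
  case base
  then show ?case by simp
next
  case (step1 i)
  then show ?case by (simp add: phipow_Suc phi_add)
next
  case (step2 i)
  have "phi (phipow phi (i - 1) (x + y)) = phi (phipow phi (i - 1) x + phipow phi (i - 1) y)"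
    using phipow_Suc[of "i - 1"] step2 by (simp add: phi_add)
  then show ?case using bij_phi by (simp add: bij_def inj_eq)
qed

lemma additive_phipow: "additive (phipow phi m)"
  by unfold_locales (rule phipow_additive)

lemmas phipow_zero [simp] = additive.zero[OF additive_phipow]
  and phipow_minus = additive.minus[OF additive_phipow]
  and phipow_diff = additive.diff[OF additive_phipow]

lemma additive_int_scale: "additive g \<Longrightarrow> g (int_scale n x) = int_scale n (g x)"
  for g :: "'k \<Rightarrow> 'k"
  by (simp add: int_scale_def additive.diff additive.sum)

text \<open>This is \<open>p(\<phi>) x\<close>, so that \<open>x\<close> acts as \<open>phi\<close>.
  Plain polynomials, not Laurent polynomials, serve as scalars; negative powers of
  \<open>phi\<close> are handled by shifting with \<open>phipow\<close>.\<close>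

definition act :: "int poly \<Rightarrow> 'k \<Rightarrow> 'k" (infixr "\<cdot>" 75) where
  "p \<cdot> x = (\<Sum>i\<le>degree p. int_scale (coeff p i) ((phi ^^ i) x))"

lemma additive_funpow: "additive (phi ^^ i)"
  using additive_phipow[of "int i"] by (simp add: phipow_of_nat)

lemma act_sum: "degree p \<le> n \<Longrightarrow> p \<cdot> x = (\<Sum>i\<le>n. int_scale (coeff p i) ((phi ^^ i) x))"
  unfolding act_def
  by (rule sum.mono_neutral_left) (auto simp: coeff_eq_0 int_scale.scale_zero_left)

text \<open>Applied with \<open>g\<close> a possibly negative power of \<open>phi\<close>, this lets
  shifts pass through the polynomial action.\<close>

lemma act_commute:
  assumes "additive g" "\<And>x. g (phi x) = phi (g x)"
  shows "p \<cdot> g x = g (p \<cdot> x)"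
proof -
  have "g ((phi ^^ i) x) = (phi ^^ i) (g x)" for i
    by (induction i) (simp_all add: assms(2))
  then show ?thesis
    by (simp add: act_def additive.sum[OF assms(1)] additive_int_scale[OF assms(1)])
qed

lemma act_pCons: "pCons a p \<cdot> x = int_scale a x + phi (p \<cdot> x)"
proof -
  have "pCons a p \<cdot> x = (\<Sum>i\<le>Suc (degree p). int_scale (coeff (pCons a p) i) ((phi ^^ i) x))"
    by (rule act_sum) (rule degree_pCons_le)
  also have "\<dots> = int_scale a x + phi (p \<cdot> x)"
    by (simp add: sum.atMost_Suc_shift act_def phi.sum additive_int_scale phi.additive_axioms
        del: sum.atMost_Suc)
  finally show ?thesis .
qed

lemma act_add_right: "p \<cdot> (x + y) = p \<cdot> x + p \<cdot> y"
  by (simp add: act_def additive.add[OF additive_funpow] int_scale.scale_right_distrib sum.distrib)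

lemma act_zero_left: "0 \<cdot> x = 0"
  by (simp add: act_def int_scale.scale_zero_left)

lemma act_add_left: "(p + q) \<cdot> x = p \<cdot> x + q \<cdot> x"
proof -
  let ?n = "max (degree p) (degree q)"
  have "(p + q) \<cdot> x = (\<Sum>i\<le>?n. int_scale (coeff (p + q) i) ((phi ^^ i) x))"
    by (rule act_sum) (rule degree_add_le_max)
  also have "\<dots> = p \<cdot> x + q \<cdot> x"
    by (simp add: int_scale.scale_left_distrib sum.distrib act_sum[of p ?n] act_sum[of q ?n])
  finally show ?thesis .
qed

lemma act_smult: "smult a p \<cdot> x = int_scale a (p \<cdot> x)"
proof -
  have "smult a p \<cdot> x = (\<Sum>i\<le>degree p. int_scale (coeff (smult a p) i) ((phi ^^ i) x))"
    by (rule act_sum) (rule degree_smult_le)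
  then show ?thesis by (simp add: act_def int_scale.scale_sum_right)
qed

sublocale int_poly_module act
proof
  fix p q :: "int poly" and x y :: 'k
  show "p \<cdot> (x + y) = p \<cdot> x + p \<cdot> y" by (rule act_add_right)
  show "(p + q) \<cdot> x = p \<cdot> x + q \<cdot> x" by (rule act_add_left)
  show "p \<cdot> (q \<cdot> x) = (p * q) \<cdot> x"
    by (induction p)
      (auto simp: act_zero_left act_pCons act_add_left act_smult int_scale.scale_zero_left)
  show "1 \<cdot> x = x"
    by (simp add: act_def)
qed

lemma act_monom: "monom 1 n \<cdot> x = (phi ^^ n) x"
  by (induction n) (simp_all add: monom_Suc act_pCons int_scale.scale_zero_left flip: one_pCons)

lemma act_phipow: "p \<cdot> phipow phi m x = phipow phi m (p \<cdot> x)"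
  by (rule act_commute[OF additive_phipow phipow_commute])

section \<open>The group structure, words and balls\<close>

sublocale sd: group "sdmul phi" sdone "sdinv phi"
  by unfold_locales
    (auto simp: sdmul_def sdone_def sdinv_def phipow_additive phipow_minus phipow_add algebra_simps)

definition word_prod :: "('k \<times> int) list \<Rightarrow> 'k \<times> int" where
  "word_prod w = foldr (sdmul phi) w sdone"

lemma word_prod_Nil [simp]: "word_prod [] = sdone"
  and word_prod_Cons [simp]: "word_prod (a # w) = sdmul phi a (word_prod w)"
  by (simp_all add: word_prod_def)

lemma word_prod_append: "word_prod (u @ v) = sdmul phi (word_prod u) (word_prod v)"
  by (induction u) (simp_all add: sd.assoc)

text \<open>Words give access to prefixes and cyclic permutations, which the recursion for balls
  hides. That recursion multiplies on the right, so the last letter is split off.\<close>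

lemma sdball_words: "sdball phi S n = word_prod ` {w. set w \<subseteq> S \<and> length w \<le> n}"
proof (induction n)
  case 0
  then show ?case by (auto simp: image_iff)
next
  case (Suc n)
  show ?case
  proof (intro equalityI subsetI)
    fix g assume "g \<in> sdball phi S (Suc n)"
    then consider "g \<in> sdball phi S n" | x s where "g = sdmul phi x s" "x \<in> sdball phi S n" "s \<in> S"
      by auto
    then show "g \<in> word_prod ` {w. set w \<subseteq> S \<and> length w \<le> Suc n}"
    proof cases
      case 1
      then show ?thesis unfolding Suc by force
    next
      case 2
      then obtain w where "x = word_prod w" "set w \<subseteq> S" "length w \<le> n" unfolding Suc by auto
      with 2 show ?thesis
        by (intro image_eqI[of _ _ "w @ [s]"]) (auto simp: word_prod_append)
    qed
  next
    fix g assume "g \<in> word_prod ` {w. set w \<subseteq> S \<and> length w \<le> Suc n}"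
    then obtain w where w: "g = word_prod w" "set w \<subseteq> S" "length w \<le> Suc n" by auto
    show "g \<in> sdball phi S (Suc n)"
    proof (cases w rule: rev_cases)
      case Nil
      then have "g \<in> sdball phi S n" unfolding Suc using w by (intro image_eqI[of _ _ "[]"]) auto
      then show ?thesis by simp
    next
      case (snoc u s)
      then have "word_prod u \<in> sdball phi S n" unfolding Suc using w by auto
      moreover have "g = sdmul phi (word_prod u) s" "s \<in> S" using w snoc by (auto simp: word_prod_append)
      ultimately show ?thesis unfolding sdball.simps by blast
    qed
  qed
qed

lemma word_prod_in_sdball: "set w \<subseteq> S \<Longrightarrow> length w \<le> n \<Longrightarrow> word_prod w \<in> sdball phi S n"
  unfolding sdball_words by auto

lemma sdball_mono: "m \<le> n \<Longrightarrow> sdball phi S m \<subseteq> sdball phi S n"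
  by (auto simp: sdball_words)

lemma sdball_mult: "g \<in> sdball phi S m \<Longrightarrow> h \<in> sdball phi S n \<Longrightarrow> sdmul phi g h \<in> sdball phi S (m + n)"
proof -
  assume "g \<in> sdball phi S m" "h \<in> sdball phi S n"
  then obtain u v where "g = word_prod u" "set u \<subseteq> S" "length u \<le> m"
    "h = word_prod v" "set v \<subseteq> S" "length v \<le> n" by (auto simp: sdball_words)
  then show ?thesis
    using word_prod_in_sdball[of "u @ v" S "m + n"] by (simp add: word_prod_append)
qed

lemma sdball_inverse:
  assumes "symmetric_gen phi S" "g \<in> sdball phi S n"
  shows "sdinv phi g \<in> sdball phi S n"
proof -
  obtain w where w: "g = word_prod w" "set w \<subseteq> S" "length w \<le> n"
    using assms(2) by (auto simp: sdball_words)
  have "sdinv phi (word_prod w) = word_prod (rev (map (sdinv phi) w))"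
    by (induction w) (auto simp: word_prod_append sd.inverse_distrib_swap)
  moreover have "set (rev (map (sdinv phi) w)) \<subseteq> S"
    using w(2) assms(1) unfolding symmetric_gen_def by (simp only: set_rev set_map) blast
  ultimately show ?thesis using w by (simp add: word_prod_in_sdball)
qed

lemma finite_sdball: "finite S \<Longrightarrow> finite (sdball phi S n)"
  unfolding sdball_words by (intro finite_imageI finite_lists_length_le)

end

section \<open>Polynomials with bounded coefficients\<close>

text \<open>Such a polynomial records how often a letter of \<open>R\<close> is read at each of
  \<open>D\<close> heights, hence the nonnegative coefficients. Here \<open>D\<close> bounds the
  degree strictly.\<close>

definition bounded_polys :: "nat \<Rightarrow> nat \<Rightarrow> int poly set" where
  "bounded_polys D C = {p. (\<forall>i. 0 \<le> coeff p i \<and> coeff p i \<le> int C) \<and> (\<forall>i\<ge>D. coeff p i = 0)}"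

lemma bounded_polys_card:
  "finite (bounded_polys D C) \<and> card (bounded_polys D C) \<le> (C + 1) ^ D"
proof -
  let ?h = "\<lambda>p :: int poly. restrict (coeff p) {..<D}"
  have inj: "inj_on ?h (bounded_polys D C)"
  proof (intro inj_onI poly_eqI)
    fix p q :: "int poly" and i
    assume pq: "p \<in> bounded_polys D C" "q \<in> bounded_polys D C" and eq: "?h p = ?h q"
    show "coeff p i = coeff q i"
    proof (cases "i < D")
      case True
      then show ?thesis using eq by (metis lessThan_iff restrict_apply')
    next
      case False
      then show ?thesis using pq by (simp add: bounded_polys_def)
    qed
  qed
  have im: "?h ` bounded_polys D C \<subseteq> {..<D} \<rightarrow>\<^sub>E {0..int C}"
    by (rule image_subsetI) (unfold restrict_PiE_iff, simp add: bounded_polys_def)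
  have fin: "finite ({..<D} \<rightarrow>\<^sub>E {0..int C})" by (rule finite_PiE) auto
  have "card ({..<D} \<rightarrow>\<^sub>E {0..int C}) = (C + 1) ^ D"
    by (simp add: card_PiE nat_add_distrib)
  then show ?thesis
    using card_inj_on_le[OF inj im fin] inj_on_finite[OF inj im fin] by simp
qed

lemma bounded_polys_mono: "C \<le> C' \<Longrightarrow> bounded_polys D C \<subseteq> bounded_polys D C'"
  unfolding bounded_polys_def by (auto intro: order_trans[of _ "int C"])

lemma bounded_polys_add:
  "p \<in> bounded_polys D A \<Longrightarrow> q \<in> bounded_polys D B \<Longrightarrow> p + q \<in> bounded_polys D (A + B)"
  by (auto simp: bounded_polys_def intro: add_mono)

lemma bounded_polys_monom: "l < D \<Longrightarrow> monom 1 l \<in> bounded_polys D 1"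
  by (auto simp: bounded_polys_def)

lemma bounded_polys_smult:
  "p \<in> bounded_polys D A \<Longrightarrow> 0 \<le> c \<Longrightarrow> c \<le> int C \<Longrightarrow> smult c p \<in> bounded_polys D (C * A)"
  by (auto simp: bounded_polys_def intro!: mult_mono)

lemma bounded_polys_sum:
  assumes "finite I" "\<And>i. i \<in> I \<Longrightarrow> p i \<in> bounded_polys D A"
  shows "(\<Sum>i\<in>I. p i) \<in> bounded_polys D (card I * A)"
  using assms
proof (induction I rule: finite_induct)
  case empty
  then show ?case by (simp add: bounded_polys_def)
next
  case (insert i I)
  then have "p i + (\<Sum>i\<in>I. p i) \<in> bounded_polys D (A + card I * A)"
    by (intro bounded_polys_add) auto
  then show ?case using insert by simp
qed

text \<open>Since \<open>x^i = (x^d - 1) x^(i-d) + x^(i-d)\<close>, the exponent is lowered by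
  \<open>d\<close> repeatedly. Each round adds one monomial to the quotient, and there are at most
  \<open>i\<close> rounds.\<close>

lemma monom_reduce:
  assumes "d > 0" "i < D"
  shows "\<exists>q\<in>bounded_polys D i. \<exists>r\<in>bounded_polys d 1. monom 1 i = (monom 1 d - 1) * q + r"
  using assms(2)
proof (induction i rule: less_induct)
  case (less i)
  show ?case
  proof (cases "i < d")
    case True
    then show ?thesis
      by (intro bexI[of _ 0] bexI[of _ "monom 1 i"]) (auto simp: bounded_polys_monom bounded_polys_def)
  next
    case False
    then have "i - d < i" "i - d < D" using less(2) assms(1) by auto
    from less(1)[OF this] obtain q r where qr: "q \<in> bounded_polys D (i - d)" "r \<in> bounded_polys d 1"
      "monom 1 (i - d) = (monom 1 d - 1) * q + r" by blast
    have "monom 1 i = monom 1 d * monom (1::int) (i - d)"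
      using False by (simp add: mult_monom)
    also have "\<dots> = (monom 1 d - 1) * (q + monom 1 (i - d)) + r"
    proof -
      have r: "r = monom 1 (i - d) - (monom 1 d - 1) * q" using qr(3) by simp
      show ?thesis unfolding r by (simp add: ring_distribs)
    qed
    finally have "monom 1 i = \<dots>" .
    moreover have "i - d + 1 \<le> i" using False assms(1) by simp
    then have "q + monom 1 (i - d) \<in> bounded_polys D i"
      using bounded_polys_add[OF qr(1) bounded_polys_monom[OF \<open>i - d < D\<close>]] bounded_polys_mono by blast
    ultimately show ?thesis using qr(2) by blast
  qed
qed

text \<open>Divide monomial by monomial. At most \<open>D\<close> terms are summed, each scaled by
  at most \<open>C\<close>, with quotient coefficients up to \<open>D\<close> and remainder
  coefficients up to 1.\<close>

lemma bounded_polys_reduce: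
  assumes "d > 0" "p \<in> bounded_polys D C"
  shows "\<exists>q\<in>bounded_polys D (C * (D * D)). \<exists>r\<in>bounded_polys d (C * D). p = (monom 1 d - 1) * q + r"
proof -
  have "\<forall>i<D. \<exists>q r. q \<in> bounded_polys D i \<and> r \<in> bounded_polys d 1 \<and> monom 1 i = (monom 1 d - 1) * q + r"
    using monom_reduce[OF assms(1)] by blast
  then obtain q r where qr: "\<And>i. i < D \<Longrightarrow> q i \<in> bounded_polys D i" "\<And>i. i < D \<Longrightarrow> r i \<in> bounded_polys d 1"
    "\<And>i. i < D \<Longrightarrow> monom 1 i = (monom 1 d - 1) * q i + r i" by metis
  have c: "0 \<le> coeff p i" "coeff p i \<le> int C" "i \<ge> D \<Longrightarrow> coeff p i = 0" for i
    using assms(2) by (auto simp: bounded_polys_def)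
  have "p = (\<Sum>i<D. smult (coeff p i) (monom 1 i))"
    by (rule poly_eqI) (auto simp: coeff_sum c if_distrib cong: if_cong)
  also have "\<dots> = (\<Sum>i<D. smult (coeff p i) ((monom 1 d - 1) * q i + r i))"
    using qr(3) by (intro sum.cong) auto
  also have "\<dots> = (monom 1 d - 1) * (\<Sum>i<D. smult (coeff p i) (q i)) + (\<Sum>i<D. smult (coeff p i) (r i))"
    by (simp add: smult_add_right sum.distrib sum_distrib_left)
  finally have "p = \<dots>" .
  moreover have "(\<Sum>i<D. smult (coeff p i) (q i)) \<in> bounded_polys D (card {..<D} * (C * D))"
    using qr(1) bounded_polys_mono[OF less_imp_le] c(1,2)
    by (intro bounded_polys_sum bounded_polys_smult) blast+
  moreover have "(\<Sum>i<D. smult (coeff p i) (r i)) \<in> bounded_polys d (card {..<D} * (C * 1))"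
    using qr(2) c(1,2) by (intro bounded_polys_sum bounded_polys_smult) blast+
  moreover have "card {..<D} * (C * D) = C * (D * D)" "card {..<D} * (C * 1) = C * D" by simp_all
  ultimately show ?thesis by metis
qed

text \<open>Divide \<open>e\<close> times by \<open>x^d - 1\<close> and keep the \<open>e\<close>
  remainders, each with \<open>d\<close> coefficients. Every division enlarges the coefficient bound
  of the quotient by \<open>D^2\<close>, which explains \<open>(D * D) ^ e\<close>. The size of
  \<open>T\<close> depends on \<open>D\<close> only through this bound and not in the
  exponent.\<close>

lemma bounded_polys_residues:
  assumes "d > 0"
  shows "\<exists>T. finite T \<and> card T \<le> ((C * (D * D) ^ e + 1) ^ d) ^ e
    \<and> (\<forall>p\<in>bounded_polys D C. \<exists>s\<in>T. \<exists>a. p = s + (monom 1 d - 1) ^ e * a)"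
proof (induction e arbitrary: C)
  case 0
  show ?case by (intro exI[of _ "{0}"]) auto
next
  case (Suc e)
  define f :: "int poly" where "f = monom 1 d - 1"
  define X where "X = (C * (D * D) ^ Suc e + 1) ^ d"
  obtain T where T: "finite T" "card T \<le> X ^ e"
    "\<And>p. p \<in> bounded_polys D (C * (D * D)) \<Longrightarrow> \<exists>s\<in>T. \<exists>a. p = s + f ^ e * a"
    using Suc[of "C * (D * D)"] by (auto simp: f_def X_def mult.assoc)
  let ?P = "bounded_polys d (C * (D * D) ^ Suc e)"
  let ?T = "(\<lambda>(r, s). r + f * s) ` (?P \<times> T)"
  have P: "finite ?P" "card ?P \<le> X" unfolding X_def using bounded_polys_card by auto
  have "card ?T \<le> card ?P * card T"
    using card_image_le[of "?P \<times> T"] P(1) T(1) by (simp add: card_cartesian_product)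
  also have "\<dots> \<le> X * X ^ e" using P(2) T(2) by (rule mult_le_mono)
  finally have "card ?T \<le> X ^ Suc e" by simp
  moreover have "\<exists>t\<in>?T. \<exists>a. p = t + f ^ Suc e * a" if p: "p \<in> bounded_polys D C" for p
  proof -
    obtain q r where qr: "q \<in> bounded_polys D (C * (D * D))" "r \<in> bounded_polys d (C * D)" "p = f * q + r"
      using bounded_polys_reduce[OF assms p] by (auto simp: f_def)
    obtain s a where s: "s \<in> T" "q = s + f ^ e * a" using T(3)[OF qr(1)] by auto
    \<comment> \<open>The first remainder has coefficients up to \<open>C D\<close>; this puts it
      under the bound shared by all remainders.\<close>
    have "D \<le> (D * D) ^ Suc e"
    proof (cases "D = 0")
      case False
      then have "D * D \<le> (D * D) ^ Suc e" by (intro self_le_power) simp_all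
      then show ?thesis using le_square le_trans by blast
    qed simp
    then have "C * D \<le> C * (D * D) ^ Suc e" by (rule mult_le_mono2)
    from bounded_polys_mono[OF this] qr(2) have "r \<in> ?P" by (rule subsetD)
    moreover have "p = (r + f * s) + f ^ Suc e * a"
      unfolding qr(3) s(2) distrib_left power_Suc mult.assoc by (simp only: add.assoc add.commute add.left_commute)
    ultimately show ?thesis using s(1) by force
  qed
  moreover have "finite ?T" using P(1) T(1) by (intro finite_imageI finite_cartesian_product)
  ultimately show ?case unfolding f_def X_def by blast
qed

section \<open>Periodic elements\<close>

lemma funpow_fixed: "(f ^^ d) x = x \<Longrightarrow> (f ^^ (d * j)) x = x"
  by (induction j) (simp_all add: funpow_add)

context abelian_automorphism
begin

lemma funpow_phi_inj: "(phi ^^ n) x = (phi ^^ n) y \<Longrightarrow> x = y"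
  using phipow_minus_cancel(1)[of "int n"] by (metis phipow_of_nat)

lemma monom_minus_1_act: "(monom 1 d - 1) \<cdot> x = (phi ^^ d) x - x"
  by (simp add: scale_left_diff_distrib act_monom)

lemma fixed_iff_act: "(phi ^^ d) x = x \<longleftrightarrow> (monom 1 d - 1) \<cdot> x = 0"
  by (simp add: monom_minus_1_act)

text \<open>One exponent \<open>e\<close> serves all \<open>d\<close> and all periods
  \<open>j\<close>; this uniformity keeps the later residue counts at
  \<open>n ^ O(L)\<close>.\<close>

definition separates_periodic :: "nat \<Rightarrow> nat \<Rightarrow> bool" where
  "separates_periodic d0 e \<longleftrightarrow> (\<forall>d j a. j > 0 \<longrightarrow>
     (phi ^^ j) ((monom 1 (d0 * d) - 1) ^ e \<cdot> a) = (monom 1 (d0 * d) - 1) ^ e \<cdot> a \<longrightarrow>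
     (monom 1 (d0 * d) - 1) ^ e \<cdot> a = 0)"

lemma separates_periodicD:
  "separates_periodic d0 e \<Longrightarrow> j > 0 \<Longrightarrow> (phi ^^ j) y = y \<Longrightarrow> y = (monom 1 (d0 * d) - 1) ^ e \<cdot> a \<Longrightarrow> y = 0"
  unfolding separates_periodic_def by blast

lemma subspace_act_kernel: "subspace {x. p \<cdot> x = 0}"
  by (rule subspaceI) (auto simp: scale_right_distrib, metis mult.commute scale_scale scale_zero_right)

end

section \<open>The generating set, and polynomial expressions for words\<close>

locale semidirect_gen = abelian_automorphism phi for phi :: "'k::ab_group_add \<Rightarrow> 'k" +
  fixes R :: "'k set"
  assumes finR: "finite R" and symR: "\<forall>r\<in>R. - r \<in> R"
    and gen: "sdgenerates phi ((\<lambda>r. (r, 0)) ` R \<union> {(0, 1), (0, - 1)})"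
begin

definition S :: "('k \<times> int) set" where
  "S = (\<lambda>r. (r, 0)) ` R \<union> {(0, 1), (0, - 1)}"

lemma finite_S: "finite S" using finR by (simp add: S_def)

lemma symmetric_S: "symmetric_gen phi S"
  using symR by (auto simp: symmetric_gen_def S_def sdinv_def)

lemma abs_snd_word_prod_le:
  "set w \<subseteq> S \<Longrightarrow> \<bar>snd (word_prod w)\<bar> \<le> int (length w)"
proof (induction w)
  case Nil
  then show ?case by (simp add: sdone_def)
next
  case (Cons s w)
  then have "s \<in> S" "\<bar>snd (word_prod w)\<bar> \<le> int (length w)" by auto
  then show ?case by (auto simp: S_def sdmul_def)
qed

text \<open>A letter \<open>(r, 0)\<close> read at height \<open>h\<close> contributes
  \<open>\<phi>^h r\<close>. After the shift by \<open>a\<close> this is a monomial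
  \<open>x^(h+a)\<close> acting on \<open>r\<close>, with exponent in the window
  \<open>0, ..., D - 1\<close>. Letters are appended on the right, which leaves the heights of the
  earlier prefixes unchanged.\<close>

lemma word_prod_polys:
  assumes "set w \<subseteq> S"
    and "\<forall>i\<le>length w. 0 \<le> snd (word_prod (take i w)) + int a
      \<and> snd (word_prod (take i w)) + int a < int D"
  shows "\<exists>p. (\<forall>r\<in>R. p r \<in> bounded_polys D (length w))
    \<and> (phi ^^ a) (fst (word_prod w)) = (\<Sum>r\<in>R. p r \<cdot> r)"
  using assms
proof (induction w rule: rev_induct)
  case Nil
  have "fst (sdone :: 'k \<times> int) = 0" by (simp add: sdone_def)
  then show ?case
    using phipow_zero[of "int a"] by (intro exI[of _ "\<lambda>_. 0"]) (auto simp: bounded_polys_def phipow_of_nat)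
next
  case (snoc s w)
  define h where "h = snd (word_prod w)"
  define l where "l = nat (h + int a)"
  have hD: "0 \<le> h + int a" "h + int a < int D"
    using snoc.prems(2)[rule_format, of "length w"] by (simp_all add: h_def)
  have "\<forall>i\<le>length w. 0 \<le> snd (word_prod (take i w)) + int a
      \<and> snd (word_prod (take i w)) + int a < int D"
  proof (intro allI impI)
    fix i assume "i \<le> length w"
    then show "0 \<le> snd (word_prod (take i w)) + int a
      \<and> snd (word_prod (take i w)) + int a < int D"
      using snoc.prems(2)[rule_format, of i] by simp
  qed
  moreover have "set w \<subseteq> S" using snoc.prems(1) by simp
  ultimately obtain p where p: "\<And>r. r \<in> R \<Longrightarrow> p r \<in> bounded_polys D (length w)"
    "(phi ^^ a) (fst (word_prod w)) = (\<Sum>r\<in>R. p r \<cdot> r)" using snoc.IH by blast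
  have mono: "p r \<in> bounded_polys D (Suc (length w))" if "r \<in> R" for r
    using p(1)[OF that] bounded_polys_mono[of "length w" "Suc (length w)" D] by auto
  have fst: "fst (word_prod (w @ [s])) = fst (word_prod w) + phipow phi h (fst s)"
    by (simp add: word_prod_append sdmul_def h_def sdone_def)
  consider r where "r \<in> R" "s = (r, 0)" | "fst s = 0"
    using snoc.prems(1) by (auto simp: S_def)
  then show ?case
  proof cases
    case 1
    have al: "int a + h = int l" using hD by (simp add: l_def)
    have "(phi ^^ a) (phipow phi h r) = (phi ^^ l) r"
      by (simp add: al flip: phipow_of_nat phipow_add)
    then have "(phi ^^ a) (fst (word_prod (w @ [s]))) = (\<Sum>r\<in>R. p r \<cdot> r) + monom 1 l \<cdot> r"
      unfolding fst using p(2) 1 by (simp add: additive.add[OF additive_funpow] act_monom)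
    also have "\<dots> = (\<Sum>r'\<in>R. (p(r := p r + monom 1 l)) r' \<cdot> r')"
      using 1 finR by (simp add: sum.remove[of R r] scale_left_distrib algebra_simps)
    finally have "(phi ^^ a) (fst (word_prod (w @ [s]))) = \<dots>" .
    moreover have "p r + monom 1 l \<in> bounded_polys D (Suc (length w))"
      using bounded_polys_add[OF p(1)[OF 1(1)] bounded_polys_monom[of l D]] hD by (simp add: l_def)
    ultimately show ?thesis using mono by (intro exI[of _ "p(r := p r + monom 1 l)"]) auto
  next
    case 2
    then show ?thesis using p(2) mono by (auto simp: fst)
  qed
qed

text \<open>All heights lie between \<open>-n\<close> and \<open>n\<close>, so the shift
  \<open>n\<close> and a window of \<open>2 n + 1\<close> heights suffice.\<close>

lemma ball_polys:
  assumes "g \<in> sdball phi S n"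
  shows "\<exists>p. (\<forall>r\<in>R. p r \<in> bounded_polys (2 * n + 1) n) \<and> (phi ^^ n) (fst g) = (\<Sum>r\<in>R. p r \<cdot> r)"
proof -
  obtain w where w: "g = word_prod w" "set w \<subseteq> S" "length w \<le> n"
    using assms by (auto simp: sdball_words)
  have "\<bar>snd (word_prod (take i w))\<bar> \<le> int n" for i
  proof -
    have "\<bar>snd (word_prod (take i w))\<bar> \<le> int (length (take i w))"
      by (rule abs_snd_word_prod_le) (use w set_take_subset in fast)
    then show ?thesis using w(3) by auto
  qed
  note B = this
  have "\<forall>i\<le>length w. 0 \<le> snd (word_prod (take i w)) + int n
      \<and> snd (word_prod (take i w)) + int n < int (2 * n + 1)"
    using B by (auto simp: abs_le_iff) (smt (verit))+
  then obtain p where "\<forall>r\<in>R. p r \<in> bounded_polys (2 * n + 1) (length w)"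
    "(phi ^^ n) (fst (word_prod w)) = (\<Sum>r\<in>R. p r \<cdot> r)"
    using word_prod_polys[OF w(2)] by blast
  moreover have "bounded_polys (2 * n + 1) (length w) \<subseteq> bounded_polys (2 * n + 1) n"
    using w(3) by (rule bounded_polys_mono)
  ultimately show ?thesis using w(1) by blast
qed

text \<open>\<open>R\<close> generates K with the help of negative powers of \<open>phi\<close>, so
  a shift may be needed to reach \<open>span R\<close>. Since shifts are injective and commute with
  the action, finiteness results pass from \<open>span R\<close> to all of K.\<close>

lemma eventually_in_span: "\<exists>n. (phi ^^ n) k \<in> span R"
proof -
  from gen have "(k, 0) \<in> (\<Union>n. sdball phi S n)" by (simp add: sdgenerates_def S_def)
  then obtain n where "(k, 0) \<in> sdball phi S n" by auto
  from ball_polys[OF this] obtain p where "(phi ^^ n) k = (\<Sum>r\<in>R. p r \<cdot> r)" by auto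
  also have "\<dots> \<in> span R" by (intro span_sum span_scale span_base)
  finally show ?thesis by blast
qed

text \<open>The periodic elements of \<open>span R\<close> form a submodule, which is finitely
  generated; the product of the periods of its generators is a common period.\<close>

lemma uniform_period:
  "\<exists>d0>0. \<forall>d>0. \<forall>k. (phi ^^ d) k = k \<longrightarrow> (phi ^^ d0) k = k"
proof -
  define P where "P = {k \<in> span R. \<exists>d>0. (phi ^^ d) k = k}"
  have "subspace P"
  proof (rule subspaceI)
    show "0 \<in> P" using additive.zero[OF additive_funpow, of 1]
      by (auto simp: P_def span_zero intro!: exI[of _ 1])
  next
    fix x y assume "x \<in> P" "y \<in> P"
    then obtain c d where cd: "c > 0" "(phi ^^ c) x = x" "d > 0" "(phi ^^ d) y = y" "x \<in> span R" "y \<in> span R"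
      by (auto simp: P_def)
    have "(phi ^^ (c * d)) (x + y) = x + y"
      using funpow_fixed[OF cd(2), of d] funpow_fixed[OF cd(4), of c]
      by (simp add: additive.add[OF additive_funpow] mult.commute)
    then show "x + y \<in> P" using cd by (auto simp: P_def span_add intro!: exI[of _ "c * d"])
  next
    fix c x assume "x \<in> P"
    then obtain d where d: "d > 0" "(phi ^^ d) x = x" "x \<in> span R" by (auto simp: P_def)
    have "(phi ^^ d) (c \<cdot> x) = c \<cdot> x"
      using act_phipow[of c "int d" x] d(2) by (simp add: phipow_of_nat)
    then show "c \<cdot> x \<in> P" using d by (auto simp: P_def span_scale)
  qed
  then obtain F where F: "finite F" "F \<subseteq> P" "P \<subseteq> span F"
    using noetherian[OF finR, of P] by (auto simp: P_def)
  from F(2) have "\<forall>x\<in>F. \<exists>d>0. (phi ^^ d) x = x" by (auto simp: P_def)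
  then obtain c where c: "\<And>x. x \<in> F \<Longrightarrow> c x > 0 \<and> (phi ^^ c x) x = x" by metis
  define d0 where "d0 = prod c F"
  have "d0 > 0" unfolding d0_def using c by (simp add: prod_pos)
  have fixF: "(phi ^^ d0) x = x" if "x \<in> F" for x
    unfolding d0_def prod.remove[OF F(1) that] by (rule funpow_fixed) (use c that in auto)
  have "span F \<subseteq> {x. (monom 1 d0 - 1) \<cdot> x = 0}"
    by (rule span_minimal) (use fixF fixed_iff_act subspace_act_kernel in auto)
  then have fixP: "(phi ^^ d0) x = x" if "x \<in> P" for x
    using that F(3) fixed_iff_act by auto
  have "(phi ^^ d0) k = k" if "d > 0" "(phi ^^ d) k = k" for d k
  proof -
    obtain n where n: "(phi ^^ n) k \<in> span R" using eventually_in_span by blast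
    have "(phi ^^ d) ((phi ^^ n) k) = (phi ^^ n) k"
      using that(2) by (metis comp_apply funpow_add add.commute)
    with n that(1) have "(phi ^^ n) k \<in> P" by (auto simp: P_def)
    from fixP[OF this] have "(phi ^^ n) ((phi ^^ d0) k) = (phi ^^ n) k"
      by (metis comp_apply funpow_add add.commute)
    then show ?thesis by (rule funpow_phi_inj)
  qed
  with \<open>d0 > 0\<close> show ?thesis by blast
qed

text \<open>The same scheme: the elements of \<open>span R\<close> killed by some power of
  \<open>g\<close> form a finitely generated submodule, and the sum of the exponents of its
  generators kills all of it.\<close>

lemma kernel_chain_stable: "\<exists>e. \<forall>E k. g ^ E \<cdot> k = 0 \<longrightarrow> g ^ e \<cdot> k = 0"
proof -
  define U where "U = {k \<in> span R. \<exists>E. g ^ E \<cdot> k = 0}"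
  have up: "g ^ E' \<cdot> k = 0" if "g ^ E \<cdot> k = 0" "E \<le> E'" for E E' k
  proof -
    have "g ^ E' = g ^ (E' - E) * g ^ E" using that(2) by (simp flip: power_add)
    then show ?thesis using that(1) by (metis scale_scale scale_zero_right)
  qed
  have "subspace U"
  proof (rule subspaceI)
    show "0 \<in> U" by (simp add: U_def span_zero)
  next
    fix x y assume "x \<in> U" "y \<in> U"
    then obtain c d where cd: "g ^ c \<cdot> x = 0" "g ^ d \<cdot> y = 0" "x \<in> span R" "y \<in> span R"
      by (auto simp: U_def)
    have "g ^ (c + d) \<cdot> (x + y) = 0"
      using up[OF cd(1), of "c + d"] up[OF cd(2), of "c + d"] by (simp add: scale_right_distrib)
    then show "x + y \<in> U" using cd by (auto simp: U_def span_add)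
  next
    fix c x assume "x \<in> U"
    then obtain d where d: "g ^ d \<cdot> x = 0" "x \<in> span R" by (auto simp: U_def)
    have "g ^ d \<cdot> (c \<cdot> x) = c \<cdot> (g ^ d \<cdot> x)" by (simp add: mult.commute)
    then have "g ^ d \<cdot> (c \<cdot> x) = 0" using d(1) by simp
    then show "c \<cdot> x \<in> U" using d unfolding U_def by (auto intro: span_scale)
  qed
  then obtain F where F: "finite F" "F \<subseteq> U" "U \<subseteq> span F"
    using noetherian[OF finR, of U] by (auto simp: U_def)
  from F(2) have "\<forall>x\<in>F. \<exists>E. g ^ E \<cdot> x = 0" by (auto simp: U_def)
  then obtain c where c: "\<And>x. x \<in> F \<Longrightarrow> g ^ c x \<cdot> x = 0" by metis
  define e where "e = sum c F"
  have "g ^ e \<cdot> x = 0" if "x \<in> F" for x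
    using up[OF c[OF that]] member_le_sum[of x F c] that F(1) by (simp add: e_def)
  then have "span F \<subseteq> {x. g ^ e \<cdot> x = 0}"
    by (intro span_minimal) (use subspace_act_kernel in auto)
  then have fixU: "g ^ e \<cdot> x = 0" if "x \<in> U" for x
    using that F(3) by auto
  have "g ^ e \<cdot> k = 0" if "g ^ E \<cdot> k = 0" for E k
  proof -
    obtain n where n: "(phi ^^ n) k \<in> span R" using eventually_in_span by blast
    have comm: "p \<cdot> (phi ^^ n) k = (phi ^^ n) (p \<cdot> k)" for p
      using act_phipow[of p "int n"] by (simp add: phipow_of_nat)
    have "g ^ E \<cdot> (phi ^^ n) k = 0"
      unfolding comm that by (rule additive.zero[OF additive_funpow])
    with n have "(phi ^^ n) k \<in> U" by (auto simp: U_def)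
    from fixU[OF this] have "(phi ^^ n) (g ^ e \<cdot> k) = (phi ^^ n) 0"
      unfolding comm additive.zero[OF additive_funpow] .
    then show ?thesis by (rule funpow_phi_inj)
  qed
  then show ?thesis by blast
qed

text \<open>With \<open>g = x^d0 - 1\<close>, a divisor of \<open>x^(d0 d) - 1\<close>, the element
  has the form \<open>y = g^e0 b\<close>. If \<open>y\<close> is periodic, the common period
  \<open>d0\<close> gives \<open>g y = 0\<close>, so \<open>g^(e0+1) b = 0\<close>, and stability of
  the kernels gives \<open>y = g^e0 b = 0\<close>.\<close>

lemma ex_separates_periodic: "\<exists>d0>0. \<exists>e. separates_periodic d0 e"
proof -
  obtain d0 where d0: "d0 > 0" "\<And>d k. d > 0 \<Longrightarrow> (phi ^^ d) k = k \<Longrightarrow> (phi ^^ d0) k = k"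
    using uniform_period by blast
  define g :: "int poly" where "g = monom 1 d0 - 1"
  obtain e0 where e0: "\<And>E k. g ^ E \<cdot> k = 0 \<Longrightarrow> g ^ e0 \<cdot> k = 0"
    using kernel_chain_stable[of g] by blast
  have "y = 0" if "j > 0" "(phi ^^ j) y = y" and y: "y = (monom 1 (d0 * d) - 1) ^ e0 \<cdot> a" for d j y a
  proof -
    have "monom 1 (d0 * d) - 1 = (monom (1::int) d0) ^ d - 1"
      by (simp add: monom_power mult.commute)
    also have "\<dots> = g * (\<Sum>i<d. monom 1 d0 ^ i)"
      unfolding g_def by (rule power_diff_1_eq)
    finally have "y = g ^ e0 \<cdot> ((\<Sum>i<d. monom 1 d0 ^ i) ^ e0 \<cdot> a)"
      unfolding y by (simp add: power_mult_distrib)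
    moreover have "g \<cdot> y = 0"
      using d0(2)[OF that(1,2)] by (simp add: g_def fixed_iff_act)
    ultimately have "g ^ (Suc e0) \<cdot> ((\<Sum>i<d. monom 1 d0 ^ i) ^ e0 \<cdot> a) = 0"
      by simp
    from e0[OF this] show ?thesis using \<open>y = g ^ e0 \<cdot> _\<close> by simp
  qed
  with d0(1) show ?thesis unfolding separates_periodic_def by blast
qed

text \<open>
  For \<open>\<mu> > 0\<close>, both \<open>v\<close> and \<open>f\<close> divide \<open>x^(\<mu> d0 d) - 1 = v M = f N\<close>. Hence \<open>M \<kappa> - N \<eta>\<close> and then
  \<open>\<kappa> - v f^e0 b\<close> are periodic; being multiples of \<open>f^e0\<close>, they vanish.
\<close>

lemma congruent_commuting:
  assumes sep: "separates_periodic d0 e0"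
    and "d0 > 0" "d > 0" and f: "f = monom 1 (d0 * d) - 1" and v: "v = monom 1 \<mu> - 1"
    and comm: "f \<cdot> \<kappa> = v \<cdot> \<eta>" and \<kappa>: "\<kappa> = f ^ Suc e0 \<cdot> a" and \<eta>: "\<eta> = f ^ Suc e0 \<cdot> b"
  shows "\<exists>y. \<kappa> = v \<cdot> y"
proof (cases "\<mu> = 0")
  \<comment> \<open>For \<open>\<mu> = 0\<close> the relation reads \<open>f \<kappa> = 0\<close>,
    so \<open>\<kappa>\<close> is itself periodic and a multiple of \<open>f^e0\<close>.\<close>
  case True
  then have "v = 0" by (simp add: v monom_0 one_pCons)
  then have "(phi ^^ (d0 * d)) \<kappa> = \<kappa>" using comm by (simp add: f fixed_iff_act)
  moreover have "\<kappa> = f ^ e0 \<cdot> (f \<cdot> a)" unfolding \<kappa> by (simp add: mult.commute)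
  ultimately have "\<kappa> = 0" using assms(2,3) separates_periodicD[OF sep, of "d0 * d" \<kappa> d "f \<cdot> a"] by (simp add: f)
  then show ?thesis by (intro exI[of _ 0]) simp
next
  case False
  let ?D = "d0 * d"
  define M :: "int poly" where "M = (\<Sum>i<?D. monom 1 \<mu> ^ i)"
  define N :: "int poly" where "N = (\<Sum>i<\<mu>. monom 1 ?D ^ i)"
  have vM: "v * M = monom 1 (\<mu> * ?D) - 1"
    unfolding M_def v by (subst power_diff_1_eq[symmetric]) (simp add: monom_power mult.commute)
  have fN: "f * N = monom 1 (\<mu> * ?D) - 1"
    unfolding N_def f by (subst power_diff_1_eq[symmetric]) (simp add: monom_power mult.commute)
  define w where "w = M \<cdot> \<kappa> - N \<cdot> \<eta>"
  have "f \<cdot> (M \<cdot> \<kappa>) = M \<cdot> (f \<cdot> \<kappa>)" by (simp add: mult.commute)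
  also have "\<dots> = (v * M) \<cdot> \<eta>" by (simp add: comm mult.commute)
  also have "\<dots> = f \<cdot> (N \<cdot> \<eta>)" by (simp add: vM fN)
  finally have "f \<cdot> w = 0" by (simp add: w_def scale_right_diff_distrib)
  then have "(phi ^^ ?D) w = w" by (simp add: f fixed_iff_act)
  moreover have "w = f ^ e0 \<cdot> (f \<cdot> (M \<cdot> a - N \<cdot> b))"
    unfolding w_def \<kappa> \<eta> by (simp only: scale_right_diff_distrib scale_scale power_Suc mult.assoc mult.commute mult.left_commute)
  ultimately have "w = 0" using assms(2,3) separates_periodicD[OF sep, of ?D w d "f \<cdot> (M \<cdot> a - N \<cdot> b)"] by (simp add: f)
  then have M\<kappa>: "M \<cdot> \<kappa> = N \<cdot> \<eta>" by (simp add: w_def)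
  define u where "u = \<kappa> - v \<cdot> (f ^ e0 \<cdot> b)"
  \<comment> \<open>The extra factor \<open>f\<close> in the hypotheses is spent here:
    \<open>f N\<close> is exchanged for \<open>v M\<close>, and \<open>f^e0\<close> remains for the
    separation property.\<close>
  have "N * f ^ Suc e0 = (f * N) * f ^ e0" by (simp only: power_Suc mult.assoc mult.commute mult.left_commute)
  also have "\<dots> = (v * M) * f ^ e0" by (simp only: fN vM)
  also have "\<dots> = M * (v * f ^ e0)" by (simp only: mult.assoc mult.commute mult.left_commute)
  finally have "N \<cdot> \<eta> = M \<cdot> (v \<cdot> (f ^ e0 \<cdot> b))" unfolding \<eta> by (simp only: scale_scale mult.assoc)
  then have "M \<cdot> u = 0" using M\<kappa> by (simp add: u_def scale_right_diff_distrib)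
  then have "(v * M) \<cdot> u = 0" by (metis scale_scale scale_zero_right)
  then have "(phi ^^ (\<mu> * ?D)) u = u" by (simp add: vM fixed_iff_act)
  moreover have "u = f ^ e0 \<cdot> (f \<cdot> a - v \<cdot> b)"
    unfolding u_def \<kappa> by (simp only: scale_right_diff_distrib scale_scale power_Suc mult.assoc mult.commute mult.left_commute)
  ultimately have "u = 0" using assms(2,3) False separates_periodicD[OF sep, of "\<mu> * ?D" u d "f \<cdot> a - v \<cdot> b"] by (simp add: f)
  then show ?thesis by (intro exI[of _ "f ^ e0 \<cdot> b"]) (simp add: u_def)
qed

end

section \<open>Counting conjugacy classes\<close>

context abelian_automorphism
begin

lemma sdconjclass_conj: "sdconjclass phi (sdmul phi (sdmul phi h g) (sdinv phi h)) = sdconjclass phi g"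
proof (intro equalityI subsetI)
  fix x assume "x \<in> sdconjclass phi (sdmul phi (sdmul phi h g) (sdinv phi h))"
  then obtain k where "x = sdmul phi (sdmul phi k (sdmul phi (sdmul phi h g) (sdinv phi h))) (sdinv phi k)"
    unfolding sdconjclass_def by blast
  then have "x = sdmul phi (sdmul phi (sdmul phi k h) g) (sdinv phi (sdmul phi k h))"
    by (simp add: sd.assoc sd.inverse_distrib_swap)
  then show "x \<in> sdconjclass phi g" unfolding sdconjclass_def by blast
next
  fix x assume "x \<in> sdconjclass phi g"
  then obtain k where "x = sdmul phi (sdmul phi k g) (sdinv phi k)"
    unfolding sdconjclass_def by blast
  moreover have "sdmul phi (sdinv phi h) (sdmul phi h y) = y" for y
    by (simp add: sd.assoc[symmetric])
  ultimately have "x = sdmul phi (sdmul phi (sdmul phi k (sdinv phi h))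
      (sdmul phi (sdmul phi h g) (sdinv phi h))) (sdinv phi (sdmul phi k (sdinv phi h)))"
    by (simp add: sd.assoc sd.inverse_distrib_swap)
  then show "x \<in> sdconjclass phi (sdmul phi (sdmul phi h g) (sdinv phi h))"
    unfolding sdconjclass_def by blast
qed

lemma sdconjclass_eq: "x \<in> sdconjclass phi g \<Longrightarrow> sdconjclass phi x = sdconjclass phi g"
proof -
  assume "x \<in> sdconjclass phi g"
  then obtain h where "x = sdmul phi (sdmul phi h g) (sdinv phi h)" unfolding sdconjclass_def by blast
  then show ?thesis by (simp only: sdconjclass_conj)
qed

text \<open>Conjugating \<open>(k', m)\<close> by \<open>(y, 0)\<close> adds
  \<open>y - \<phi>^m y\<close> to the first component.\<close>

lemma sdconjclass_translate:
  assumes "k - k' = y - phipow phi m y"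
  shows "sdconjclass phi (k, m) = sdconjclass phi (k', m)"
proof -
  have "sdmul phi (sdmul phi (y, 0) (k', m)) (sdinv phi (y, 0)) = (k, m)"
    using assms by (simp add: sdmul_def sdinv_def phipow_minus algebra_simps)
  then show ?thesis using sdconjclass_conj by metis
qed

end

section \<open>Residues, narrow words and coinciding cyclic permutations\<close>

context semidirect_gen
begin

text \<open>Reduce each of the polynomials from \<open>ball_polys\<close>, one for each
  \<open>r\<close> in \<open>R\<close>, and undo the shift by \<open>\<phi>^n\<close>, which
  commutes with the action.\<close>

lemma ball_residues:
  assumes "d > 0"
  shows "\<exists>T. finite T \<and> card T \<le> (n * ((2 * n + 1) * (2 * n + 1)) ^ e + 1) ^ (d * e * card R)
    \<and> (\<forall>g\<in>sdball phi S n. \<exists>t\<in>T. \<exists>a. fst g = t + (monom 1 d - 1) ^ e \<cdot> a)"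
proof -
  define f :: "int poly" where "f = monom 1 d - 1"
  define X where "X = n * ((2 * n + 1) * (2 * n + 1)) ^ e + 1"
  obtain T where T: "finite T" "card T \<le> (X ^ d) ^ e"
    "\<And>p. p \<in> bounded_polys (2 * n + 1) n \<Longrightarrow> \<exists>s\<in>T. \<exists>a. p = s + f ^ e * a"
    using bounded_polys_residues[OF assms, of n "2 * n + 1" e] unfolding f_def X_def by blast
  let ?h = "\<lambda>s. phipow phi (- int n) (\<Sum>r\<in>R. s r \<cdot> r)"
  let ?T = "?h ` (R \<rightarrow>\<^sub>E T)"
  have fin: "finite (R \<rightarrow>\<^sub>E T)" using finR T(1) by (simp add: finite_PiE)
  have "card ?T \<le> card T ^ card R"
    using card_image_le[OF fin, of ?h] finR by (simp add: card_PiE)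
  also have "\<dots> \<le> ((X ^ d) ^ e) ^ card R" using T(2) by (rule power_mono) simp
  finally have "card ?T \<le> X ^ (d * e * card R)" by (simp add: power_mult)
  moreover have "\<exists>t\<in>?T. \<exists>a. fst g = t + f ^ e \<cdot> a" if g: "g \<in> sdball phi S n" for g
  proof -
    obtain p where p: "\<And>r. r \<in> R \<Longrightarrow> p r \<in> bounded_polys (2 * n + 1) n"
      "(phi ^^ n) (fst g) = (\<Sum>r\<in>R. p r \<cdot> r)" using ball_polys[OF g] by auto
    have "\<forall>r\<in>R. \<exists>s a. s \<in> T \<and> p r = s + f ^ e * a" using T(3)[OF p(1)] by blast
    then obtain s a where sa: "\<And>r. r \<in> R \<Longrightarrow> s r \<in> T" "\<And>r. r \<in> R \<Longrightarrow> p r = s r + f ^ e * a r"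
      by metis
    have "phipow phi (int n) (fst g) = (\<Sum>r\<in>R. restrict s R r \<cdot> r) + f ^ e \<cdot> (\<Sum>r\<in>R. a r \<cdot> r)"
      unfolding phipow_of_nat p(2)
      by (simp add: sa(2) scale_left_distrib sum.distrib scale_sum_right)
    then have "phipow phi (- int n) (phipow phi (int n) (fst g))
        = ?h (restrict s R) + f ^ e \<cdot> phipow phi (- int n) (\<Sum>r\<in>R. a r \<cdot> r)"
      by (simp only: phipow_additive act_phipow)
    then have "fst g = ?h (restrict s R) + f ^ e \<cdot> phipow phi (- int n) (\<Sum>r\<in>R. a r \<cdot> r)"
      by simp
    moreover have "restrict s R \<in> R \<rightarrow>\<^sub>E T" using sa(1) by auto
    ultimately show ?thesis by blast
  qed
  ultimately show ?thesis using fin unfolding f_def X_def by (intro exI[of _ ?T]) auto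
qed

text \<open>The shift \<open>a\<close> moves the heights of all prefixes into
  \<open>0, ..., D - 1\<close>; bounding it by \<open>n\<close> leaves only \<open>n + 1\<close>
  positions of the window to count.\<close>

definition narrow :: "nat \<Rightarrow> nat \<Rightarrow> ('k \<times> int) set" where
  "narrow n D = {word_prod w | w. set w \<subseteq> S \<and> length w \<le> n \<and>
     (\<exists>a\<le>n. \<forall>i\<le>length w. 0 \<le> snd (word_prod (take i w)) + int a
        \<and> snd (word_prod (take i w)) + int a < int D)}"

text \<open>The shift, the final height and the polynomials of \<open>word_prod_polys\<close>
  determine the element; the three factors count these choices.\<close>

lemma card_narrow:
  "finite (narrow n D) \<and> card (narrow n D) \<le> (n + 1) * (2 * n + 1) * (n + 1) ^ (D * card R)"
proof -
  let ?P = "bounded_polys D n"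
  let ?h = "\<lambda>(a, m, p). (phipow phi (- int a) (\<Sum>r\<in>R. p r \<cdot> r), m)"
  let ?A = "{..n} \<times> {- int n..int n} \<times> (R \<rightarrow>\<^sub>E ?P)"
  have fin: "finite ?A" using finR bounded_polys_card by (simp add: finite_PiE)
  have "narrow n D \<subseteq> ?h ` ?A"
  proof
    fix g assume "g \<in> narrow n D"
    then obtain w a where w: "g = word_prod w" "set w \<subseteq> S" "length w \<le> n" "a \<le> n"
      "\<forall>i\<le>length w. 0 \<le> snd (word_prod (take i w)) + int a
        \<and> snd (word_prod (take i w)) + int a < int D" by (auto simp: narrow_def)
    from word_prod_polys[OF w(2,5)] obtain p where
      p: "\<And>r. r \<in> R \<Longrightarrow> p r \<in> bounded_polys D (length w)"
        "(phi ^^ a) (fst g) = (\<Sum>r\<in>R. p r \<cdot> r)" by (auto simp: w(1))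
    have "phipow phi (- int a) (phipow phi (int a) (fst g)) = phipow phi (- int a) (\<Sum>r\<in>R. restrict p R r \<cdot> r)"
      unfolding phipow_of_nat p(2) by simp
    then have "g = ?h (a, snd g, restrict p R)" by (simp add: prod_eq_iff)
    moreover have "restrict p R \<in> R \<rightarrow>\<^sub>E ?P" using p(1) bounded_polys_mono[OF w(3)] by auto
    moreover have "snd g \<in> {- int n..int n}"
      using abs_snd_word_prod_le[OF w(2)] w(1,3) by auto
    ultimately show "g \<in> ?h ` ?A" using w(4) by blast
  qed
  then have "finite (narrow n D)" "card (narrow n D) \<le> card ?A"
    using fin by (auto intro: finite_subset surj_card_le)
  moreover have "card {- int n..int n} = 2 * n + 1" unfolding card_atLeastAtMost_int by linarith
  then have "card ?A = (n + 1) * ((2 * n + 1) * card ?P ^ card R)"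
    using finR by (simp only: card_cartesian_product card_PiE card_atMost prod_constant Suc_eq_plus1)
  moreover have "card ?P ^ card R \<le> ((n + 1) ^ D) ^ card R"
    using bounded_polys_card by (intro power_mono) auto
  then have "(n + 1) * ((2 * n + 1) * card ?P ^ card R)
      \<le> (n + 1) * ((2 * n + 1) * ((n + 1) ^ D) ^ card R)"
    by (intro mult_le_mono2)
  ultimately show ?thesis unfolding power_mult mult.assoc by linarith
qed

text \<open>Heights start at 0 and change by at most 1 per letter. A value \<open>c \<ge> 0\<close>
  is met on the way from the start to \<open>j\<close>, a negative one on the way to
  \<open>i\<close>.\<close>

lemma heights_intermediate:
  assumes "set w \<subseteq> S" "i \<le> length w" "j \<le> length w"
    and "snd (word_prod (take i w)) \<le> c" "c \<le> snd (word_prod (take j w))"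
  shows "\<exists>l\<le>length w. snd (word_prod (take l w)) = c"
proof -
  let ?H = "\<lambda>i. snd (word_prod (take i w))"
  have step: "\<bar>?H (l + 1) - ?H l\<bar> \<le> 1" for l
  proof (cases "l < length w")
    case True
    then have "w ! l \<in> S" using assms(1) by auto
    then have "\<bar>snd (w ! l)\<bar> \<le> 1" by (auto simp: S_def)
    then show ?thesis using True by (simp add: take_Suc_conv_app_nth word_prod_append sdmul_def sdone_def)
  qed simp
  have H0: "?H 0 = 0" by (simp add: sdone_def)
  show ?thesis
  proof (cases "c \<ge> 0")
    case True
    then obtain l where "l \<le> j" "?H l = c"
      using nat0_intermed_int_val[of j ?H c] step assms(5) H0 by metis
    then show ?thesis using assms(3) le_trans by blast
  next
    case False
    have "\<forall>l<i. \<bar>- ?H (l + 1) - - ?H l\<bar> \<le> 1"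
    proof (intro allI impI)
      fix l show "\<bar>- ?H (l + 1) - - ?H l\<bar> \<le> 1" using step[of l] by linarith
    qed
    moreover have "- ?H 0 \<le> - c" "- c \<le> - ?H i" using False H0 assms(4) by linarith+
    ultimately obtain l where "l \<le> i" "- ?H l = - c"
      using nat0_intermed_int_val[of i "\<lambda>l. - ?H l" "- c"] by blast
    then show ?thesis using assms(2) by (intro exI[of _ l]) simp
  qed
qed

text \<open>For a prefix \<open>p j\<close> of the word, the cyclic permutation is
  \<open>c j = p_j^(-1) g p_j\<close>. Hence \<open>c i = c j\<close> says exactly that
  \<open>p_i^(-1) p_j\<close> commutes with \<open>c i\<close>, and its height is the difference of
  the two prefix heights.\<close>

lemma conj_trichotomy:
  assumes "set w \<subseteq> S" "length w \<le> n" "d0 > 0" and g: "g = word_prod w"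
  shows "g \<in> narrow n (d0 * L + 1)
    \<or> L < card (sdconjclass phi g \<inter> sdball phi S n)
    \<or> (\<exists>g'\<in>sdball phi S n \<inter> sdconjclass phi g. \<exists>z\<in>sdball phi S (2 * n). \<exists>d\<in>{1..L}.
        snd z = int (d0 * d) \<and> sdmul phi g' z = sdmul phi z g')"
proof -
  let ?H = "\<lambda>i. snd (word_prod (take i w))"
  define lo where "lo = Min (?H ` {..length w})"
  define hi where "hi = Max (?H ` {..length w})"
  have H0: "?H 0 = 0" by (simp add: sdone_def)
  have bounds: "lo \<le> ?H i \<and> ?H i \<le> hi" if "i \<le> length w" for i
    unfolding lo_def hi_def using that by auto
  have "lo \<in> ?H ` {..length w}" "hi \<in> ?H ` {..length w}"
    unfolding lo_def hi_def by (rule Min_in Max_in; simp)+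
  then obtain il ih where il: "il \<le> length w" "?H il = lo" and ih: "ih \<le> length w" "?H ih = hi" by auto
  have "\<bar>lo\<bar> \<le> int (length (take il w))"
    unfolding il(2)[symmetric] by (rule abs_snd_word_prod_le) (use assms(1) set_take_subset in fast)
  \<comment> \<open>The shift for \<open>narrow\<close> is \<open>- lo\<close>; it is nonnegative
    because the empty prefix has height 0.\<close>
  then have lo: "lo \<le> 0" "nat (- lo) \<le> n" using bounds[of 0] H0 assms(2) by auto
  show ?thesis
  proof (cases "hi - lo < int (d0 * L + 1)")
    case True
    have "\<forall>i\<le>length w. 0 \<le> ?H i + int (nat (- lo)) \<and> ?H i + int (nat (- lo)) < int (d0 * L + 1)"
    proof (intro allI impI)
      fix i assume "i \<le> length w"
      then show "0 \<le> ?H i + int (nat (- lo)) \<and> ?H i + int (nat (- lo)) < int (d0 * L + 1)"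
        using bounds[of i] lo(1) True by linarith
    qed
    then have "g \<in> narrow n (d0 * L + 1)" unfolding narrow_def using assms(1,2) lo(2) g by blast
    then show ?thesis by blast
  next
    case False
    \<comment> \<open>The spacing \<open>d0\<close> makes every height difference a multiple of
      \<open>d0\<close>, as \<open>separates_periodic\<close> requires.\<close>
    have "\<exists>l\<le>length w. ?H l = lo + int (d0 * j)" if "j \<le> L" for j
    proof (rule heights_intermediate[OF assms(1) il(1) ih(1)])
      have "int (d0 * j) \<le> int (d0 * L)" using that by (intro of_nat_mono mult_le_mono2)
      then show "lo + int (d0 * j) \<le> ?H ih" using False ih(2) by linarith
    qed (simp add: il(2))
    then obtain l where l: "\<And>j. j \<le> L \<Longrightarrow> l j \<le> length w \<and> ?H (l j) = lo + int (d0 * j)"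
      by metis
    define p where "p j = word_prod (take (l j) w)" for j
    define c where "c j = word_prod (drop (l j) w @ take (l j) w)" for j
    have pc: "sdmul phi (p j) (c j) = sdmul phi g (p j)" for j
      unfolding p_def c_def g using word_prod_append[of "take (l j) w" "drop (l j) w"]
      by (simp add: word_prod_append sd.assoc)
    have c_conj: "c j = sdmul phi (sdmul phi (sdinv phi (p j)) g) (sdinv phi (sdinv phi (p j)))" for j
    proof -
      have "sdmul phi (sdinv phi (p j)) (sdmul phi (p j) (c j)) = c j"
        by (simp add: sd.assoc[symmetric])
      then show ?thesis using pc[of j] by (simp add: sd.assoc)
    qed
    have c_class: "c j \<in> sdconjclass phi g" for j
      unfolding sdconjclass_def c_conj by blast
    have c_ball: "c j \<in> sdball phi S n" for j
      unfolding c_def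
    proof (rule word_prod_in_sdball)
      show "set (drop (l j) w @ take (l j) w) \<subseteq> S"
        using assms(1) set_take_subset[of "l j" w] set_drop_subset[of "l j" w] by auto
    qed (use assms(2) in auto)
    show ?thesis
    proof (cases "inj_on c {..L}")
      case True
      have "card (c ` {..L}) = L + 1" using card_image[OF True] by simp
      moreover have "card (c ` {..L}) \<le> card (sdconjclass phi g \<inter> sdball phi S n)"
        by (rule card_mono) (use c_class c_ball finite_sdball[OF finite_S] in auto)
      ultimately show ?thesis by simp
    next
      case inj: False
      obtain i j where ij: "i < j" "j \<le> L" "c i = c j"
      proof -
        from inj obtain a b where "a \<le> L" "b \<le> L" "a \<noteq> b" "c a = c b" by (auto simp: inj_on_def)
        then show ?thesis using that[of a b] that[of b a] by (cases "a < b") auto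
      qed
      define z where "z = sdmul phi (sdinv phi (p i)) (p j)"
      have pball: "p i \<in> sdball phi S n" for i
        unfolding p_def by (rule word_prod_in_sdball)
          (use assms(1,2) set_take_subset[of "l i" w] in auto)
      have "z \<in> sdball phi S (n + n)"
        unfolding z_def by (intro sdball_mult sdball_inverse symmetric_S pball)
      moreover have "snd z = int (d0 * (j - i))"
        using l[of i] l[of j] ij unfolding z_def p_def
        by (simp add: sdmul_def sdinv_def of_nat_diff algebra_simps)
      moreover have "sdmul phi (c i) z = sdmul phi z (c i)"
      proof -
        have "sdmul phi (c i) z = sdmul phi (sdinv phi (p i)) (sdmul phi g (p j))"
          unfolding z_def c_conj by (simp add: sd.assoc) (simp add: sd.assoc[symmetric])
        also have "\<dots> = sdmul phi z (c j)"
          by (simp add: z_def sd.assoc pc)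
        finally show ?thesis using ij(3) by simp
      qed
      moreover have "j - i \<in> {1..L}" using ij by auto
      ultimately show ?thesis using c_ball[of i] c_class[of i] by (metis IntI mult_2)
    qed
  qed
qed

text \<open>Commutation of \<open>g\<close> and \<open>z\<close> means
  \<open>f k = (\<phi>^m - 1) h\<close> for their first components. Subtracting the two such
  relations leaves differences that are multiples of \<open>f^(e0+1)\<close>, so
  \<open>congruent_commuting\<close> puts \<open>\<kappa>\<close> into the image of
  \<open>\<phi>^m - 1\<close>, and a translation conjugates \<open>g\<close> to
  \<open>g'\<close>.\<close>

lemma sdconjclass_eq_of_congruent:
  assumes sep: "separates_periodic d0 e0"
    and "d0 > 0" "d > 0" and f: "f = monom 1 (d0 * d) - 1"
    and snd: "snd g' = snd g" "snd z = int (d0 * d)" "snd z' = int (d0 * d)"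
    and comm: "sdmul phi g z = sdmul phi z g" "sdmul phi g' z' = sdmul phi z' g'"
    and res: "fst g = t + f ^ Suc e0 \<cdot> a" "fst g' = t + f ^ Suc e0 \<cdot> a'"
      "fst z = s + f ^ Suc e0 \<cdot> b" "fst z' = s + f ^ Suc e0 \<cdot> b'"
  shows "sdconjclass phi g = sdconjclass phi g'"
proof -
  define m where "m = snd g"
  define \<kappa> where "\<kappa> = fst g - fst g'"
  define \<eta> where "\<eta> = fst z - fst z'"
  have c: "f \<cdot> fst g = phipow phi m (fst z) - fst z" "f \<cdot> fst g' = phipow phi m (fst z') - fst z'"
    using comm snd unfolding f monom_minus_1_act phipow_of_nat[symmetric] m_def
    by (auto simp: sdmul_def algebra_simps)
  have fk: "f \<cdot> \<kappa> = phipow phi m \<eta> - \<eta>"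
    unfolding \<kappa>_def \<eta>_def using c by (simp add: scale_right_diff_distrib phipow_diff)
  have \<kappa>: "\<kappa> = f ^ Suc e0 \<cdot> (a - a')" and \<eta>: "\<eta> = f ^ Suc e0 \<cdot> (b - b')"
    unfolding \<kappa>_def \<eta>_def res by (simp_all add: scale_right_diff_distrib del: power_Suc)
  have "\<exists>y. \<kappa> = y - phipow phi m y"
  proof (cases "m \<ge> 0")
    case True
    then have pm: "phipow phi m x - x = (monom 1 (nat m) - 1) \<cdot> x" for x
      using phipow_of_nat[of "nat m"] by (simp add: monom_minus_1_act)
    obtain y where "\<kappa> = (monom 1 (nat m) - 1) \<cdot> y"
      using congruent_commuting[OF sep \<open>d0 > 0\<close> \<open>d > 0\<close> f refl fk[unfolded pm] \<kappa> \<eta>] by blast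
    then have "\<kappa> = (- y) - phipow phi m (- y)" by (simp add: phipow_minus flip: pm)
    then show ?thesis by blast
  next
    case False
    then have pm: "phipow phi (- m) x - x = (monom 1 (nat (- m)) - 1) \<cdot> x" for x
      using phipow_of_nat[of "nat (- m)"] by (simp add: monom_minus_1_act)
    \<comment> \<open>For negative \<open>m\<close> the relation is shifted by
      \<open>\<phi>^(-m)\<close>, which turns \<open>\<phi>^m - 1\<close> acting on
      \<open>\<eta>\<close> into the polynomial \<open>x^(-m) - 1\<close> acting on
      \<open>- \<eta>\<close>.\<close>
    have c1: "f \<cdot> phipow phi (- m) \<kappa> = (monom 1 (nat (- m)) - 1) \<cdot> (- \<eta>)"
      unfolding act_phipow fk by (simp add: phipow_diff phipow_minus flip: pm)
    have c2: "phipow phi (- m) \<kappa> = f ^ Suc e0 \<cdot> phipow phi (- m) (a - a')"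
      unfolding \<kappa> act_phipow ..
    have c3: "- \<eta> = f ^ Suc e0 \<cdot> (- (b - b'))" unfolding \<eta> by (simp only: scale_minus_right)
    obtain y where "phipow phi (- m) \<kappa> = (monom 1 (nat (- m)) - 1) \<cdot> y"
      using congruent_commuting[OF sep \<open>d0 > 0\<close> \<open>d > 0\<close> f refl c1 c2 c3] by blast
    then have "phipow phi (- m) \<kappa> = phipow phi (- m) y - y" by (simp add: pm)
    then have "phipow phi m (phipow phi (- m) \<kappa>) = y - phipow phi m y"
      by (simp add: phipow_diff)
    then show ?thesis by auto
  qed
  then obtain y where "fst g - fst g' = y - phipow phi m y" by (auto simp: \<kappa>_def)
  from sdconjclass_translate[OF this] show ?thesis
    using snd(1) by (metis m_def prod.collapse)
qed

text \<open>The three cases of \<open>conj_trichotomy\<close> become three kinds of classes.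
  Multiplying by \<open>L + 1\<close> keeps the estimate in the naturals. \<open>X\<close> comes
  from \<open>ball_residues\<close> at radius \<open>2 n\<close>, which contains both commuting
  elements.\<close>

lemma nconj_le:
  assumes sep: "separates_periodic d0 e0" and "d0 > 0"
    and X: "X = 2 * n * ((4 * n + 1) * (4 * n + 1)) ^ Suc e0 + 1"
  shows "nconj phi (sdball phi S n) * (L + 1) \<le> card (sdball phi S n)
    + (L + 1) * ((n + 1) * (2 * n + 1) * (n + 1) ^ ((d0 * L + 1) * card R)
      + (2 * n + 1) * (L * (X ^ (d0 * L * Suc e0 * card R)) ^ 2))"
proof -
  let ?B = "sdball phi S n" and ?cl = "sdconjclass phi"
  let ?N = "narrow n (d0 * L + 1)"
  define Y where "Y = X ^ (d0 * L * Suc e0 * card R)"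
  have finB: "finite ?B" by (rule finite_sdball[OF finite_S])
  define Good where "Good = {C \<in> ?cl ` ?B. L < card (C \<inter> ?B)}"
  define Bad where "Bad = ?cl ` ?B - Good - ?cl ` ?N"
  have fin: "finite Good" "finite Bad" using finB by (auto simp: Good_def Bad_def)
  \<comment> \<open>Distinct classes are disjoint, and each good one takes at least
    \<open>L + 1\<close> elements of the ball.\<close>
  have "(\<Sum>C\<in>Good. L + 1) \<le> (\<Sum>C\<in>Good. card (C \<inter> ?B))"
    by (rule sum_mono) (auto simp: Good_def)
  also have "\<dots> = card (\<Union>C\<in>Good. C \<inter> ?B)"
  proof (rule card_UN_disjoint[symmetric])
    show "\<forall>C\<in>Good. \<forall>C'\<in>Good. C \<noteq> C' \<longrightarrow> C \<inter> ?B \<inter> (C' \<inter> ?B) = {}"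
    proof (intro ballI impI, rule ccontr)
      fix C C' assume CC: "C \<in> Good" "C' \<in> Good" "C \<noteq> C'" "C \<inter> ?B \<inter> (C' \<inter> ?B) \<noteq> {}"
      then obtain x g g' where "x \<in> C" "x \<in> C'" "C = ?cl g" "C' = ?cl g'" unfolding Good_def by blast
      then have "?cl x = C" "?cl x = C'" using sdconjclass_eq by blast+
      then show False using CC(3) by simp
    qed
  qed (use fin finB in auto)
  also have "\<dots> \<le> card ?B" using finB by (intro card_mono) auto
  finally have good: "card Good * (L + 1) \<le> card ?B" by simp
  have "\<exists>T. finite T \<and> card T \<le> X ^ (d0 * d * Suc e0 * card R) \<and>
      (\<forall>g\<in>sdball phi S (2 * n). \<exists>t\<in>T. \<exists>a. fst g = t + (monom 1 (d0 * d) - 1) ^ Suc e0 \<cdot> a)"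
    if "d > 0" for d
    using ball_residues[of "d0 * d" "2 * n" "Suc e0"] that assms(2)
    unfolding X by (simp del: power_Suc)
  then obtain T where T: "\<And>d. d > 0 \<Longrightarrow> finite (T d)"
    "\<And>d. d > 0 \<Longrightarrow> card (T d) \<le> X ^ (d0 * d * Suc e0 * card R)"
    "\<And>d g. d > 0 \<Longrightarrow> g \<in> sdball phi S (2 * n) \<Longrightarrow>
      \<exists>t\<in>T d. \<exists>a. fst g = t + (monom 1 (d0 * d) - 1) ^ Suc e0 \<cdot> a"
    by metis
  define Data where "Data = {- int n..int n} \<times> (SIGMA d:{1..L}. T d \<times> T d)"
  \<comment> \<open>\<open>C\<close> has a representative of height \<open>m\<close> with residue
    \<open>t\<close> that commutes with an element of height \<open>d0 d\<close> and residue
    \<open>s\<close>. Such data determine \<open>C\<close>, whence the injectivity of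
    \<open>h\<close> below.\<close>
  define rel where "rel C x \<longleftrightarrow> (case x of (m, d, t, s) \<Rightarrow> \<exists>g z a b. C = ?cl g \<and> snd g = m \<and> snd z = int (d0 * d)
      \<and> sdmul phi g z = sdmul phi z g \<and> fst g = t + (monom 1 (d0 * d) - 1) ^ Suc e0 \<cdot> a
      \<and> fst z = s + (monom 1 (d0 * d) - 1) ^ Suc e0 \<cdot> b)" for C x
  have finData: "finite Data" unfolding Data_def using T(1) by (intro finite_cartesian_product finite_SigmaI) auto
  have "card (SIGMA d:{1..L}. T d \<times> T d) = (\<Sum>d\<in>{1..L}. card (T d) * card (T d))"
    using T(1) by (subst card_SigmaI) (auto simp: card_cartesian_product)
  also have "\<dots> \<le> (\<Sum>d\<in>{1..L}. Y * Y)"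
  proof (rule sum_mono)
    fix d assume d: "d \<in> {1..L}"
    have "X ^ (d0 * d * Suc e0 * card R) \<le> Y"
      unfolding Y_def using d by (intro power_increasing mult_le_mono) (auto simp: X)
    then have "card (T d) \<le> Y" using T(2)[of d] d by auto
    then show "card (T d) * card (T d) \<le> Y * Y" by (intro mult_le_mono)
  qed
  finally have "card (SIGMA d:{1..L}. T d \<times> T d) \<le> L * Y ^ 2" by (simp add: power2_eq_square)
  moreover have "card {- int n..int n} = 2 * n + 1" unfolding card_atLeastAtMost_int by linarith
  ultimately have cardData: "card Data \<le> (2 * n + 1) * (L * Y ^ 2)"
    unfolding Data_def card_cartesian_product by (simp only: mult_le_mono2)
  have "\<exists>x\<in>Data. rel C x" if C: "C \<in> Bad" for C
  proof -
    from C obtain g where g: "g \<in> ?B" "C = ?cl g" "g \<notin> ?N" "\<not> L < card (C \<inter> ?B)"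
      by (auto simp: Bad_def Good_def)
    from g(1) obtain w where w: "g = word_prod w" "set w \<subseteq> S" "length w \<le> n"
      by (auto simp: sdball_words)
    from conj_trichotomy[OF w(2,3) assms(2) w(1), of L] g obtain g' z d where
      g': "g' \<in> ?B" "g' \<in> ?cl g" and z: "z \<in> sdball phi S (2 * n)" "snd z = int (d0 * d)"
      and d: "d \<in> {1..L}" and comm: "sdmul phi g' z = sdmul phi z g'"
      by blast
    have "g' \<in> sdball phi S (2 * n)" using g'(1) sdball_mono[of n "2 * n"] by auto
    then obtain t a where t: "t \<in> T d" "fst g' = t + (monom 1 (d0 * d) - 1) ^ Suc e0 \<cdot> a"
      using T(3)[of d g'] d by auto
    obtain s b where s: "s \<in> T d" "fst z = s + (monom 1 (d0 * d) - 1) ^ Suc e0 \<cdot> b"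
      using T(3)[of d z] d z(1) by auto
    obtain w' where w': "g' = word_prod w'" "set w' \<subseteq> S" "length w' \<le> n"
      using g'(1) by (auto simp: sdball_words)
    have "snd g' \<in> {- int n..int n}"
      using abs_snd_word_prod_le[OF w'(2)] w'(1,3) by auto
    then have "(snd g', d, t, s) \<in> Data" using d t(1) s(1) by (simp add: Data_def)
    moreover have "rel C (snd g', d, t, s)"
      unfolding rel_def prod.case using g(2) sdconjclass_eq[OF g'(2)] z(2) comm t(2) s(2) by metis
    ultimately show ?thesis by blast
  qed
  then obtain h where h: "\<And>C. C \<in> Bad \<Longrightarrow> h C \<in> Data \<and> rel C (h C)" by metis
  have "inj_on h Bad"
  proof (rule inj_onI)
    fix C C' assume CC: "C \<in> Bad" "C' \<in> Bad" "h C = h C'"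
    obtain m d t s where x: "h C = (m, d, t, s)" by (metis prod.collapse)
    have "d > 0" using h[OF CC(1)] x by (auto simp: Data_def)
    have r: "rel C (m, d, t, s)" "rel C' (m, d, t, s)" using h[OF CC(1)] h[OF CC(2)] x CC(3) by auto
    from r(1) obtain g z a b where 1: "C = ?cl g" "snd g = m" "snd z = int (d0 * d)"
      "sdmul phi g z = sdmul phi z g" "fst g = t + (monom 1 (d0 * d) - 1) ^ Suc e0 \<cdot> a"
      "fst z = s + (monom 1 (d0 * d) - 1) ^ Suc e0 \<cdot> b" unfolding rel_def prod.case by blast
    from r(2) obtain g' z' a' b' where 2: "C' = ?cl g'" "snd g' = m" "snd z' = int (d0 * d)"
      "sdmul phi g' z' = sdmul phi z' g'" "fst g' = t + (monom 1 (d0 * d) - 1) ^ Suc e0 \<cdot> a'"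
      "fst z' = s + (monom 1 (d0 * d) - 1) ^ Suc e0 \<cdot> b'" unfolding rel_def prod.case by blast
    have "snd g' = snd g" using 1(2) 2(2) by simp
    from sdconjclass_eq_of_congruent[OF sep assms(2) \<open>d > 0\<close> refl this 1(3) 2(3) 1(4) 2(4) 1(5) 2(5) 1(6) 2(6)]
    show "C = C'" using 1(1) 2(1) by simp
  qed
  then have "card Bad \<le> card Data" using h finData by (intro card_inj_on_le) auto
  then have bad: "card Bad \<le> (2 * n + 1) * (L * Y ^ 2)" using cardData by linarith
  have "card (?cl ` ?N) \<le> card ?N" using card_narrow by (intro card_image_le) blast
  then have nar: "card (?cl ` ?N) \<le> (n + 1) * (2 * n + 1) * (n + 1) ^ ((d0 * L + 1) * card R)"
    using card_narrow le_trans by blast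
  have "?cl ` ?B \<subseteq> Good \<union> (?cl ` ?N \<union> Bad)" by (auto simp: Bad_def)
  then have "card (?cl ` ?B) \<le> card (Good \<union> (?cl ` ?N \<union> Bad))"
    using fin card_narrow by (intro card_mono) auto
  also have "\<dots> \<le> card Good + (card (?cl ` ?N) + card Bad)"
    by (meson add_le_mono card_Un_le le_refl le_trans)
  finally have "nconj phi ?B \<le> card Good + (card (?cl ` ?N) + card Bad)" by (simp add: nconj_def)
  then have "nconj phi ?B * (L + 1) \<le> (card Good + (card (?cl ` ?N) + card Bad)) * (L + 1)"
    by (rule mult_le_mono1)
  also have "\<dots> = card Good * (L + 1) + (L + 1) * (card (?cl ` ?N) + card Bad)"
    by (simp add: algebra_simps)
  also have "\<dots> \<le> card ?B + (L + 1) * ((n + 1) * (2 * n + 1) * (n + 1) ^ ((d0 * L + 1) * card R)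
      + (2 * n + 1) * (L * Y ^ 2))"
    using good nar bad by (intro add_mono mult_le_mono2) auto
  finally show ?thesis unfolding Y_def .
qed

text \<open>\<open>X\<close> is polynomial in \<open>n\<close> and all error terms are powers of
  \<open>X\<close> with exponent linear in \<open>L\<close>, so one constant independent of
  \<open>n\<close> and \<open>L\<close> absorbs everything.\<close>

lemma nconj_le_power:
  "\<exists>A. \<forall>n\<ge>2. \<forall>L\<le>n. real (nconj phi (sdball phi S n))
     \<le> real (card (sdball phi S n)) / real (L + 1) + 2 * real n ^ (A * (L + 1))"
proof -
  obtain d0 e0 where d0: "d0 > 0" and sep: "separates_periodic d0 e0"
    using ex_separates_periodic by blast
  \<comment> \<open>Chosen for \<open>X \<le> (5 n)^(2 (e0 + 1) + 1)\<close> together with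
    \<open>5 n \<le> n^4\<close>, valid for \<open>n \<ge> 2\<close>.\<close>
  define \<kappa> where "\<kappa> = 4 * (2 * Suc e0 + 1)"
  define A where "A = 2 + card R + d0 * card R + 2 * d0 * Suc e0 * card R"
  have "real (nconj phi (sdball phi S n))
     \<le> real (card (sdball phi S n)) / real (L + 1) + 2 * real n ^ (\<kappa> * A * (L + 1))"
    if n: "n \<ge> 2" and L: "L \<le> n" for n L
  proof -
    define X where "X = 2 * n * ((4 * n + 1) * (4 * n + 1)) ^ Suc e0 + 1"
    define U where "U = (n + 1) * (2 * n + 1) * (n + 1) ^ ((d0 * L + 1) * card R)
      + (2 * n + 1) * (L * (X ^ (d0 * L * Suc e0 * card R)) ^ 2)"
    have "1 \<le> ((4 * n + 1) * (4 * n + 1)) ^ Suc e0" by (rule one_le_power) simp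
    \<comment> \<open>This lets the prefactors \<open>n + 1\<close>, \<open>2 n + 1\<close> and
      \<open>L\<close> be replaced by \<open>X\<close>.\<close>
    from mult_le_mono2[OF this, of "2 * n"] have X1: "2 * n + 1 \<le> X"
      unfolding X_def by (simp del: power_Suc)
    have "X \<le> 2 * n * ((5 * n) * (5 * n)) ^ Suc e0 + 1"
      unfolding X_def using n by (intro add_mono mult_le_mono power_mono) auto
    also have "\<dots> \<le> 2 * n * ((5 * n) * (5 * n)) ^ Suc e0 + ((5 * n) * (5 * n)) ^ Suc e0"
      using n by (intro add_mono one_le_power) auto
    also have "\<dots> = (2 * n + 1) * ((5 * n) * (5 * n)) ^ Suc e0" by (simp add: algebra_simps)
    also have "\<dots> \<le> (5 * n) * ((5 * n) * (5 * n)) ^ Suc e0" using n by (intro mult_le_mono1) auto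
    also have "\<dots> = (5 * n) ^ (2 * Suc e0 + 1)" by (simp add: power_mult power2_eq_square power_add)
    also have "\<dots> \<le> (n ^ 4) ^ (2 * Suc e0 + 1)"
    proof (rule power_mono)
      have "(2::nat) ^ 3 \<le> n ^ 3" using n by (intro power_mono) auto
      then have "5 * n \<le> n ^ 3 * n" by (intro mult_le_mono1) simp
      then show "5 * n \<le> n ^ 4" by (simp add: numeral_eq_Suc ac_simps)
    qed simp
    finally have X\<kappa>: "X \<le> n ^ \<kappa>" by (simp only: \<kappa>_def power_mult)
    have "(n + 1) * (2 * n + 1) * (n + 1) ^ ((d0 * L + 1) * card R) \<le> X * X * X ^ ((d0 * L + 1) * card R)"
      using X1 by (intro mult_le_mono power_mono) auto
    also have "\<dots> = X ^ (2 + (d0 * L + 1) * card R)" by (simp add: power_add power2_eq_square)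
    also have "\<dots> \<le> X ^ (A * (L + 1))"
      using X1 by (intro power_increasing) (auto simp: A_def algebra_simps)
    finally have 1: "(n + 1) * (2 * n + 1) * (n + 1) ^ ((d0 * L + 1) * card R) \<le> X ^ (A * (L + 1))" .
    have "(2 * n + 1) * (L * (X ^ (d0 * L * Suc e0 * card R)) ^ 2)
        \<le> X * (X * (X ^ (d0 * L * Suc e0 * card R)) ^ 2)"
      using X1 L by (intro mult_le_mono) auto
    also have "\<dots> = X ^ (2 + d0 * L * Suc e0 * card R * 2)"
      by (simp only: power_add power_mult[symmetric]) (simp add: power2_eq_square)
    also have "\<dots> \<le> X ^ (A * (L + 1))"
      using X1 by (intro power_increasing) (auto simp: A_def algebra_simps)
    finally have "U \<le> 2 * X ^ (A * (L + 1))" using 1 unfolding U_def by linarith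
    also have "\<dots> \<le> 2 * (n ^ \<kappa>) ^ (A * (L + 1))" using X\<kappa> by (intro mult_le_mono2 power_mono) auto
    also have "\<dots> = 2 * n ^ (\<kappa> * A * (L + 1))" by (simp only: power_mult mult.assoc)
    finally have "real U \<le> real (2 * n ^ (\<kappa> * A * (L + 1)))" by (rule of_nat_mono)
    then have U: "real U \<le> 2 * real n ^ (\<kappa> * A * (L + 1))" by simp
    have "nconj phi (sdball phi S n) * (L + 1) \<le> card (sdball phi S n) + (L + 1) * U"
      unfolding U_def by (rule nconj_le[OF sep d0 X_def])
    then have "real (nconj phi (sdball phi S n) * (L + 1)) \<le> real (card (sdball phi S n) + (L + 1) * U)"
      by (rule of_nat_mono)
    then have "real (nconj phi (sdball phi S n)) * real (L + 1)
        \<le> real (card (sdball phi S n)) + real (L + 1) * real U"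
      by (simp only: of_nat_mult of_nat_add)
    then have "real (nconj phi (sdball phi S n)) \<le> real (card (sdball phi S n)) / real (L + 1) + real U"
      by (simp add: field_simps)
    with U show ?thesis by linarith
  qed
  then show ?thesis by blast
qed

text \<open>Growth is given for some generating set \<open>T\<close>. Its elements have
  \<open>S\<close>-length at most \<open>l\<close>, so \<open>T\<close>-balls of radius
  \<open>r\<close> lie in \<open>S\<close>-balls of radius \<open>l r\<close>. The rate becomes
  \<open>ln c / l\<close>, and the factor \<open>c\<close> pays for rounding \<open>n\<close> down
  to a multiple of \<open>l\<close>.\<close>

lemma ball_growth:
  assumes "sd_exp_growth phi"
  shows "\<exists>\<beta> C. \<beta> > 0 \<and> C > 0 \<and> (\<forall>n. exp (\<beta> * real n) \<le> C * real (card (sdball phi S n)))"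
proof -
  from assms obtain T c where T: "finite T" and c: "c > 1" "\<And>r. c ^ r \<le> real (card (sdball phi T r))"
    unfolding sd_exp_growth_def by blast
  have "\<forall>t\<in>T. \<exists>r. t \<in> sdball phi S r" using gen by (auto simp: sdgenerates_def S_def)
  then obtain \<rho> where \<rho>: "\<And>t. t \<in> T \<Longrightarrow> t \<in> sdball phi S (\<rho> t)" by metis
  define l where "l = Suc (sum \<rho> T)"
  have Tl: "t \<in> sdball phi S l" if "t \<in> T" for t
    using \<rho>[OF that] sdball_mono[of "\<rho> t" l S] member_le_sum[OF that _ T, of \<rho>] by (auto simp: l_def)
  have sub: "sdball phi T r \<subseteq> sdball phi S (l * r)" for r
  proof (induction r)
    case 0
    then show ?case by simp
  next
    case (Suc r)
    have "sdball phi S (l * r) \<subseteq> sdball phi S (l * Suc r)" by (rule sdball_mono) simp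
    moreover have "sdmul phi x s \<in> sdball phi S (l * Suc r)" if "x \<in> sdball phi T r" "s \<in> T" for x s
      using sdball_mult[of x S "l * r" s l] Suc that Tl[of s] by (auto simp: add.commute)
    ultimately show ?case using Suc unfolding sdball.simps by blast
  qed
  define \<beta> where "\<beta> = ln c / real l"
  have "l > 0" unfolding l_def by simp
  then have l0: "real l > 0" by simp
  have "\<beta> > 0" unfolding \<beta>_def using c(1) l0 by (intro divide_pos_pos) simp_all
  moreover have "exp (\<beta> * real n) \<le> c * real (card (sdball phi S n))" for n
  proof -
    have "n < l * (n div l + 1)" using dividend_less_times_div[OF \<open>l > 0\<close>, of n] by simp
    then have "real n \<le> real l * real (n div l + 1)" by (metis less_imp_le of_nat_le_iff of_nat_mult)
    then have "\<beta> * real n \<le> \<beta> * (real l * real (n div l + 1))"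
      using \<open>\<beta> > 0\<close> by (intro mult_left_mono) auto
    also have "\<dots> = real (n div l + 1) * ln c" using l0 by (simp add: \<beta>_def)
    finally have "exp (\<beta> * real n) \<le> exp (real (n div l + 1) * ln c)" by simp
    also have "\<dots> = c * c ^ (n div l)"
      using c(1) exp_of_nat_mult[of "n div l + 1" "ln c"] by simp
    also have "\<dots> \<le> c * real (card (sdball phi S n))"
    proof (rule mult_left_mono)
      have "sdball phi T (n div l) \<subseteq> sdball phi S n"
        using sub[of "n div l"] sdball_mono[of "l * (n div l)" n S] by simp
      then have "card (sdball phi T (n div l)) \<le> card (sdball phi S n)"
        using finite_sdball[OF finite_S] by (intro card_mono)
      with c(2)[of "n div l"] show "c ^ (n div l) \<le> real (card (sdball phi S n))" by linarith
    qed (use c(1) in simp)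
    finally show ?thesis .
  qed
  ultimately show ?thesis using c(1) by (intro exI[of _ \<beta>] exI[of _ c]) auto
qed

text \<open>With \<open>L\<close> the integer part of \<open>\<delta> n / ln n\<close>, the term
  \<open>1 / (L + 1)\<close> has the desired order, while \<open>n^(A (L + 1))\<close> uses at most
  half of the exponential growth rate, up to a polynomial factor.\<close>

lemma conjugacy_ratio:
  assumes "sd_exp_growth phi"
  shows "(\<lambda>n. real (nconj phi (sdball phi S n)) / real (card (sdball phi S n)))
    \<in> O(\<lambda>n. ln (real n) / real n)"
proof -
  obtain A where A: "\<And>n L. n \<ge> 2 \<Longrightarrow> L \<le> n \<Longrightarrow> real (nconj phi (sdball phi S n))
     \<le> real (card (sdball phi S n)) / real (L + 1) + 2 * real n ^ (A * (L + 1))"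
    using nconj_le_power by blast
  obtain \<beta> C where \<beta>: "\<beta> > 0" and C: "C > 0"
    and growth: "\<And>n. exp (\<beta> * real n) \<le> C * real (card (sdball phi S n))"
    using ball_growth[OF assms] by blast
  \<comment> \<open>The quotient ensures \<open>A \<delta> \<le> \<beta> / 2\<close>, with
    \<open>+ 2\<close> keeping the denominator positive; the minimum with 1 ensures
    \<open>L \<le> n\<close>.\<close>
  define \<delta> where "\<delta> = min 1 (\<beta> / (2 * real A + 2))"
  have \<delta>: "0 < \<delta>" "\<delta> \<le> 1" using \<beta> by (auto simp: \<delta>_def)
  have "\<delta> \<le> \<beta> / (2 * real A + 2)" by (simp add: \<delta>_def)
  then have "\<delta> * (2 * real A + 2) \<le> \<beta>" by (subst (asm) pos_le_divide_eq) simp_all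
  then have A\<delta>: "real A * \<delta> \<le> \<beta> / 2" using \<delta>(1) by (simp add: algebra_simps)
  let ?h = "\<lambda>n::nat. exp (real A * ln (real n) - \<beta> / 2 * real n)"
  \<comment> \<open>From \<open>n = 3\<close> on, \<open>ln n \<ge> 1\<close>.\<close>
  have bound: "real (nconj phi (sdball phi S n)) / real (card (sdball phi S n))
      \<le> (1 / \<delta>) * (ln (real n) / real n) + 2 * C * ?h n" if n: "n \<ge> 3" for n
  proof -
    define b where "b = real (card (sdball phi S n))"
    define q where "q = \<delta> * real n / ln (real n)"
    define L where "L = nat \<lfloor>q\<rfloor>"
    have "exp (1::real) \<le> real n" using exp_le n by linarith
    then have ln1: "ln (real n) \<ge> 1" using n by (subst ln_ge_iff) auto
    have "q \<le> \<delta> * real n / 1" unfolding q_def using ln1 \<delta> n by (intro divide_left_mono) auto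
    also have "\<dots> \<le> real n" using \<delta> by (simp add: mult_left_le_one_le)
    finally have qn: "q \<le> real n" .
    have q0: "q > 0" using \<delta> n ln1 by (simp add: q_def)
    have Lq: "real L \<le> q" "q < real (L + 1)" using q0 unfolding L_def by linarith+
    then have "L \<le> n" using qn by linarith
    have "0 < C * b" using growth[of n] exp_gt_zero[of "\<beta> * real n"] unfolding b_def by linarith
    then have b0: "b > 0" using C by (simp add: zero_less_mult_iff)
    have "1 / real (L + 1) \<le> 1 / q" using Lq q0 by (intro divide_left_mono) auto
    also have "\<dots> = (1 / \<delta>) * (ln (real n) / real n)" by (simp add: q_def)
    finally have 1: "1 / real (L + 1) \<le> (1 / \<delta>) * (ln (real n) / real n)" .
    have "real n ^ (A * (L + 1)) = exp (real (A * (L + 1)) * ln (real n))"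
      using n by (subst exp_of_nat_mult) simp
    also have "\<dots> \<le> exp (real A * ln (real n) + \<beta> / 2 * real n)"
    proof -
      have "real L * ln (real n) \<le> q * ln (real n)" using Lq ln1 by (intro mult_right_mono) auto
      also have "\<dots> = \<delta> * real n" using ln1 by (simp add: q_def)
      finally have "real A * (real L * ln (real n)) \<le> real A * (\<delta> * real n)" by (rule mult_left_mono) simp
      also have "\<dots> \<le> \<beta> / 2 * real n" using mult_right_mono[OF A\<delta>, of "real n"] by (simp add: mult.assoc)
      finally show ?thesis by (simp add: algebra_simps)
    qed
    \<comment> \<open>The full growth \<open>exp (\<beta> n)\<close> is split off for comparison
      with the ball, leaving the decaying factor \<open>n^A exp (- \<beta> n / 2)\<close>.\<close>
    also have "\<dots> = ?h n * exp (\<beta> * real n)" by (simp flip: exp_add)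
    also have "\<dots> \<le> ?h n * (C * b)" unfolding b_def using growth by (intro mult_left_mono) auto
    finally have "2 * real n ^ (A * (L + 1)) / b \<le> 2 * C * ?h n" using b0 by (simp add: field_simps)
    moreover have "real (nconj phi (sdball phi S n)) / b \<le> (b / real (L + 1) + 2 * real n ^ (A * (L + 1))) / b"
      using A[of n L] n \<open>L \<le> n\<close> b0 unfolding b_def by (intro divide_right_mono) auto
    moreover have "(b / real (L + 1) + 2 * real n ^ (A * (L + 1))) / b
        = 1 / real (L + 1) + 2 * real n ^ (A * (L + 1)) / b"
      using b0 by (simp add: add_divide_distrib)
    ultimately show ?thesis using 1 unfolding b_def by linarith
  qed
  have "(\<lambda>n. real (nconj phi (sdball phi S n)) / real (card (sdball phi S n)))
      \<in> O(\<lambda>n. (1 / \<delta>) * (ln (real n) / real n) + 2 * C * ?h n)"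
  proof (rule landau_o.big_mono)
    show "\<forall>\<^sub>F n in sequentially. norm (real (nconj phi (sdball phi S n)) / real (card (sdball phi S n)))
      \<le> norm ((1 / \<delta>) * (ln (real n) / real n) + 2 * C * ?h n)"
      using eventually_ge_at_top[of 3]
    proof eventually_elim
      case (elim n)
      then show ?case using bound[OF elim] by (simp only: real_norm_def) (smt (verit) divide_nonneg_nonneg of_nat_0_le_iff)
    qed
  qed
  also have "(\<lambda>n. (1 / \<delta>) * (ln (real n) / real n) + 2 * C * ?h n) \<in> O(\<lambda>n. ln (real n) / real n)"
  proof (rule sum_in_bigo)
    have "?h \<in> O(\<lambda>n. ln (real n) / real n)" using \<beta> by real_asymp
    then show "(\<lambda>n. 2 * C * ?h n) \<in> O(\<lambda>n. ln (real n) / real n)" by simp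
  qed (use \<delta>(1) in real_asymp)
  finally show ?thesis .
qed

end

theorem theorem1p2:
  fixes phi :: "'k::ab_group_add \<Rightarrow> 'k" and R :: "'k set"
  assumes "autom phi"
    and "finite R" and "\<forall>r\<in>R. - r \<in> R"
    and "sdgenerates phi ((\<lambda>r. (r, 0)) ` R \<union> {(0, 1), (0, -1)})"
    and "sd_exp_growth phi"
  shows "(\<lambda>n::nat. real (nconj phi (sdball phi ((\<lambda>r. (r, 0)) ` R \<union> {(0, 1), (0, -1)}) n))
            / real (card (sdball phi ((\<lambda>r. (r, 0)) ` R \<union> {(0, 1), (0, -1)}) n)))
         \<in> O(\<lambda>n. ln (real n) / real n)"
proof -
  interpret semidirect_gen phi R
    using assms by unfold_locales
  show ?thesis using conjugacy_ratio[OF assms(5)] unfolding S_def .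
qed

end
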